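(* For every integer $n\geq 1$, \[ \lambda_{n}=-\frac{1}{2}\sum_{\rho}\left(t_\rho^{n/2}-t_\rho^{-n/2}\right)^{2},\qquad t_\rho:=1-\frac{1}{\rho}, \] where $\rho$ runs over the nontrivial zeros of the Riemann zeta function $\zeta(s)$, and for each $\rho$, $t_\rho^{n/2}$ denotes any fixed choice of square root of $t_\rho^{n}$ with $t_\rho^{-n/2}:=1/t_\rho^{n/2}$ (the summand does not depend on this choice).
   Context: The nontrivial zeros $\rho$ of $\zeta$ are counted with multiplicity, and sums over $\rho$ are taken in the symmetric order, i.e. as $\lim_{T\to\infty}\sum_{|\operatorname{Im}\rho|<T}$. For integers $n\ge 1$ the Li coefficients are $\lambda_{n}=\sum_{\rho}\left[1-\left(1-\frac{1}{\rho}\right)^{n}\right]$. *)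

theory Defs
  imports "HOL-Complex_Analysis.Complex_Analysis"
begin

(* The clause f 1 = 0 only fixes the value at the pole, so that the continuation is unique
   as a total function. *)
definition zeta :: "complex \<Rightarrow> complex" where
  "zeta = (THE f. f holomorphic_on - {1} \<and> f 1 = 0 \<and>
             (\<forall>s. Re s > 1 \<longrightarrow> (\<lambda>n. 1 / of_nat (Suc n) powr s) sums f s))"

(* The exclusion of 1 removes the pole, where zeta is 0 by convention only. *)
definition nontrivial_zeros :: "complex set" where
  "nontrivial_zeros =
     {\<rho>. \<rho> \<noteq> 1 \<and> zeta \<rho> = 0 \<and> (\<nexists>k::nat. k \<ge> 1 \<and> \<rho> = - 2 * of_nat k)}"

(* The factor zorder zeta \<rho> counts each zero with its multiplicity.  Only finitely many
   nontrivial zeros satisfy \<bar>Im \<rho>\<bar> < T, so this is a genuine finite sum. *)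
definition zero_partial_sum :: "(complex \<Rightarrow> complex) \<Rightarrow> real \<Rightarrow> complex" where
  "zero_partial_sum f T =
     (\<Sum>\<rho> \<in> {\<rho> \<in> nontrivial_zeros. \<bar>Im \<rho>\<bar> < T}. of_int (zorder zeta \<rho>) * f \<rho>)"

definition zero_summable :: "(complex \<Rightarrow> complex) \<Rightarrow> bool" where
  "zero_summable f \<longleftrightarrow> (\<exists>S. (zero_partial_sum f \<longlongrightarrow> S) at_top)"

definition zero_sum :: "(complex \<Rightarrow> complex) \<Rightarrow> complex" where
  "zero_sum f = Lim at_top (zero_partial_sum f)"

definition li_coeff :: "nat \<Rightarrow> complex" where
  "li_coeff n = zero_sum (\<lambda>\<rho>. 1 - (1 - 1 / \<rho>) ^ n)"

end

theory Submission
  imports Defs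
begin

text \<open>
  The functional equation makes \<open>\<rho> \<mapsto> 1 - \<rho>\<close> a multiplicity-preserving involution of the nontrivial
  zeros that respects the symmetric truncation \<open>\<bar>Im \<rho>\<bar> < T\<close> and sends \<open>t\<^sub>\<rho>\<close> to its inverse. Averaging
  \<open>1 - t\<^sub>\<rho>^n\<close> over the involution gives \<open>(1 - t\<^sub>\<rho>^n) (1 - t\<^sub>\<rho>^(-n)) / 2 = - (t\<^sub>\<rho>^(n/2) - t\<^sub>\<rho>^(-n/2))\<^sup>2 / 2\<close>, so
  both sides already agree for every \<open>T\<close>; moreover the averaged term is \<open>O(1 / \<bar>\<rho>\<bar>\<^sup>2)\<close>, and the limits
  exist because only \<open>O(T powr (1/2))\<close> zeros have imaginary part within \<open>1/2\<close> of \<open>T\<close>.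

  The continuation of \<open>(s - 1) zeta s\<close> to \<open>Re s > -1\<close> is the trapezoidal Euler-Maclaurin series, which
  also has polynomial growth, so Jensen's inequality bounds the number of zeros. For real
  \<open>s = -a\<close> with \<open>0 < a < 1\<close> that series consists of trapezoidal errors of \<open>v \<mapsto> v powr a\<close>; writing
  these as superpositions of the errors of exponentials and summing with the partial fractions
  of the hyperbolic cotangent yields the functional equation on an interval, hence everywhere.
\<close>

section \<open>The functional equation on the interval (-1, 0)\<close>

text \<open>The interval -1 < s < 0 is chosen because everything there is nonnegative:
  \<open>v powr a\<close> is concave, so the trapezoidal rule errs to one side only, and every
  interchange of sums and integrals is an instance of Tonelli's theorem in \<open>ennreal\<close>,
  with no convergence to be checked beforehand. For the zero count the discs are centred at 2 + it,
  where the Dirichlet series bounds zeta from below uniformly in t. The growth bound is available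
  for Re s \<ge> -1/2, so such a disc has radius at most 5/2, whereas the zeros in it need a radius
  of about 1.58. The ratio of the radii is below 2, and this is what forces a Jensen bound that
  still works for close radii. Jensen gives a logarithmic count per unit of height. It is relaxed to
  a square root because any power below 1 leaves a convergent series after division by the square of
  the height, and powers can be compared with a p-series directly.\<close>

lemma Gamma_integral_powr:
  fixes c v q :: real
  assumes "c > 0" "v > 0" "q > 0"
  shows "((\<lambda>x. x powr (q * c - 1) * exp (- v * x powr q)) has_integral
           Gamma c * v powr (- c) / q) {0<..}"
proof -
  define f where "f = (\<lambda>t::real. t powr (c - 1) * exp (- t))"
  \<comment> \<open>Substitution in Euler's integral. The cases used later are \<open>q = 1\<close>,
    an exponential, and \<open>q = 2\<close>, a Gaussian.\<close>
  define g where "g = (\<lambda>x::real. v * x powr q)"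
  define g' where "g' = (\<lambda>x::real. v * (q * x powr (q - 1)))"
  have f: "(f has_integral Gamma c) {0<..}"
  proof -
    have "((\<lambda>t. t powr (c - 1) / exp t) has_integral Gamma c) {0..}"
      using Gamma_integral_real[of c] assms by simp
    hence "(f has_integral Gamma c) {0..}"
      by (simp add: f_def exp_minus field_simps)
    moreover have "negligible {x \<in> {0..} - {0<..}. f x \<noteq> 0}" "negligible {x \<in> {0<..} - {0..}. f x \<noteq> 0}"
      by (rule negligible_subset[of "{0}"]; force)+
    ultimately show ?thesis
      using has_integral_spike_set_eq by blast
  qed
  have "g ` {0<..} = {0<..}"
  proof safe
    fix y :: real assume "y > 0"
    moreover from this have "g ((y / v) powr (1 / q)) = y"
      using assms by (simp add: g_def powr_powr)
    ultimately show "y \<in> g ` {0<..}"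
      using assms by (intro image_eqI[of _ _ "(y / v) powr (1 / q)"]) auto
  qed (use assms in \<open>auto simp: g_def\<close>)
  moreover have "inj_on g {0<..}"
  proof (rule inj_onI)
    fix x y :: real assume "x \<in> {0<..}" "y \<in> {0<..}" "g x = g y"
    hence "(x powr q) powr (1 / q) = (y powr q) powr (1 / q)"
      using assms by (simp add: g_def)
    thus "x = y"
      using \<open>x \<in> {0<..}\<close> \<open>y \<in> {0<..}\<close> assms by (simp add: powr_powr)
  qed
  moreover have "(g has_field_derivative g' x) (at x within {0<..})" if "x \<in> {0<..}" for x
    using that unfolding g_def g'_def
    by (intro DERIV_subset[OF DERIV_cmult[OF has_real_derivative_powr]]) auto
  moreover have "f absolutely_integrable_on {0<..}"
    using f by (intro nonnegative_absolutely_integrable_1) (auto simp: f_def has_integral_integrable)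
  ultimately have "(\<lambda>x. \<bar>g' x\<bar> * f (g x)) absolutely_integrable_on {0<..} \<and>
           integral {0<..} (\<lambda>x. \<bar>g' x\<bar> * f (g x)) = Gamma c"
    using f by (subst has_absolute_integral_change_of_variables_1') auto
  hence "((\<lambda>x. \<bar>g' x\<bar> * f (g x)) has_integral Gamma c) {0<..}"
    by (metis has_integral_integral set_lebesgue_integral_eq_integral(1))
  hence "((\<lambda>x. v powr (-c) / q * (\<bar>g' x\<bar> * f (g x))) has_integral v powr (-c) / q * Gamma c) {0<..}"
    by (rule has_integral_mult_right)
  moreover have "v powr (-c) / q * (\<bar>g' x\<bar> * f (g x)) = x powr (q * c - 1) * exp (- v * x powr q)"
    if "x \<in> {0<..}" for x
  proof -
    have "v powr (-c) * v * v powr (c - 1) = 1"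
      using assms by (simp add: powr_minus powr_diff field_simps)
    moreover have "x powr (q - 1) * (x powr q) powr (c - 1) = x powr (q * c - 1)"
      using that by (simp add: powr_powr powr_add[symmetric] algebra_simps)
    moreover have "v powr (-c) / q * (\<bar>g' x\<bar> * f (g x)) =
        (v powr (-c) * v * v powr (c - 1)) * (x powr (q - 1) * (x powr q) powr (c - 1)) * exp (- v * x powr q)"
      using assms that by (simp add: g'_def f_def g_def powr_mult abs_mult)
    ultimately show ?thesis by simp
  qed
  ultimately show ?thesis
    by (subst has_integral_cong[where g = "\<lambda>x. v powr (-c) / q * (\<bar>g' x\<bar> * f (g x))"]) (auto simp: mult_ac)
qed

lemma nn_integral_Gamma_powr:
  fixes c v q :: real
  assumes "c > 0" "v > 0" "q > 0"
  shows "(\<integral>\<^sup>+x\<in>{0<..}. ennreal (x powr (q * c - 1) * exp (- v * x powr q)) \<partial>lborel) =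
           ennreal (Gamma c * v powr (- c) / q)"
  using assms by (intro nn_integral_has_integral_lebesgue' Gamma_integral_powr) auto

text \<open>Write \<open>1 / (x\<^sup>2 + c\<^sup>2)\<close> as the integral of
  \<open>exp (- y * (x\<^sup>2 + c\<^sup>2))\<close> over y and exchange: the x-integral is
  Gaussian, the y-integral is again a Gamma integral, and the arguments of the two Gamma values add
  up to 1, so the reflection formula produces the cosine.\<close>

lemma nn_integral_powr_over_square:
  fixes a c :: real
  assumes "\<bar>a\<bar> < 1" "c > 0"
  shows "(\<integral>\<^sup>+x\<in>{0<..}. ennreal (x powr (- a) / (x\<^sup>2 + c\<^sup>2)) \<partial>lborel) =
           ennreal (pi / (2 * cos (pi * a / 2)) * c powr (- 1 - a))"
proof -
  define h :: "real \<Rightarrow> real \<Rightarrow> ennreal" where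
    "h = (\<lambda>x y. ennreal (x powr (- a) * exp (- y * (x\<^sup>2 + c\<^sup>2))) * indicator {0<..} x * indicator {0<..} y)"
  have 1: "(\<integral>\<^sup>+y. h x y \<partial>lborel) = ennreal (x powr (- a) / (x\<^sup>2 + c\<^sup>2)) * indicator {0<..} x" for x
  proof (cases "x > 0")
    case True
    have "(\<integral>\<^sup>+y. h x y \<partial>lborel) = (\<integral>\<^sup>+y. ennreal (x powr (-a)) *
             (ennreal (y powr (1 * 1 - 1) * exp (- (x\<^sup>2 + c\<^sup>2) * y powr 1)) * indicator {0<..} y) \<partial>lborel)"
      using True by (intro nn_integral_cong) (auto simp: h_def indicator_def ennreal_mult[symmetric] algebra_simps)
    also have "\<dots> = ennreal (x powr (-a)) * ennreal (Gamma 1 * (x\<^sup>2 + c\<^sup>2) powr (- 1) / 1)"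
      using assms by (subst nn_integral_cmult, measurable, subst nn_integral_Gamma_powr) (auto intro: add_nonneg_pos)
    also have "\<dots> = ennreal (x powr (- a) / (x\<^sup>2 + c\<^sup>2))"
      using assms by (subst ennreal_mult[symmetric]) (auto simp: powr_minus field_simps Gamma_fact)
    finally show ?thesis using True by simp
  qed (auto simp: h_def)
  have 2: "(\<integral>\<^sup>+x. h x y \<partial>lborel) = ennreal (Gamma ((1 - a) / 2) / 2) *
             (ennreal (y powr (1 * ((1 + a) / 2) - 1) * exp (- c\<^sup>2 * y powr 1)) * indicator {0<..} y)" for y
  proof (cases "y > 0")
    case True
    have "(\<integral>\<^sup>+x. h x y \<partial>lborel) = (\<integral>\<^sup>+x. ennreal (exp (- c\<^sup>2 * y)) *
             (ennreal (x powr (2 * ((1 - a) / 2) - 1) * exp (- y * x powr 2)) * indicator {0<..} x) \<partial>lborel)"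
    proof (intro nn_integral_cong)
      fix x :: real
      have "x powr 2 = x\<^sup>2" if "x > 0" using that by simp
      moreover have "2 * ((1 - a) / 2) - 1 = - a" by (simp add: field_simps)
      ultimately show "h x y = ennreal (exp (- c\<^sup>2 * y)) *
             (ennreal (x powr (2 * ((1 - a) / 2) - 1) * exp (- y * x powr 2)) * indicator {0<..} x)"
        using True by (auto simp: h_def indicator_def ennreal_mult[symmetric] mult_ac exp_add[symmetric]
            distrib_left simp flip: mult.assoc)
    qed
    also have "\<dots> = ennreal (exp (- c\<^sup>2 * y)) * ennreal (Gamma ((1 - a) / 2) * y powr (- ((1 - a) / 2)) / 2)"
      using assms True by (subst nn_integral_cmult, measurable, subst nn_integral_Gamma_powr) auto
    also have "- ((1 - a) / 2) = (a - 1) / 2" by (simp add: field_simps)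
    also have "ennreal (exp (- c\<^sup>2 * y)) * ennreal (Gamma ((1 - a) / 2) * y powr ((a - 1) / 2) / 2) =
        ennreal (Gamma ((1 - a) / 2) / 2) * ennreal (y powr (1 * ((1 + a) / 2) - 1) * exp (- c\<^sup>2 * y powr 1))"
      using assms True by (simp add: ennreal_mult[symmetric] field_simps)
    finally show ?thesis using True by simp
  qed (auto simp: h_def)
  have "(\<integral>\<^sup>+x\<in>{0<..}. ennreal (x powr (- a) / (x\<^sup>2 + c\<^sup>2)) \<partial>lborel) = (\<integral>\<^sup>+x. \<integral>\<^sup>+y. h x y \<partial>lborel \<partial>lborel)"
    by (simp add: 1)
  also have "\<dots> = (\<integral>\<^sup>+y. \<integral>\<^sup>+x. h x y \<partial>lborel \<partial>lborel)"
    by (rule lborel_pair.Fubini'[symmetric]) (unfold h_def, measurable)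
  also have "\<dots> = ennreal (Gamma ((1 - a) / 2) / 2) * ennreal (Gamma ((1 + a) / 2) * (c\<^sup>2) powr (- ((1 + a) / 2)) / 1)"
    using assms unfolding 2 by (subst nn_integral_cmult, measurable, subst nn_integral_Gamma_powr) auto
  also have "\<dots> = ennreal ((Gamma ((1 - a) / 2) * Gamma ((1 + a) / 2)) / 2 * (c\<^sup>2) powr (- ((1 + a) / 2)))"
    using assms by (subst ennreal_mult[symmetric]) (auto simp: mult_ac)
  also have "(c\<^sup>2) powr (- ((1 + a) / 2)) = c powr (- 1 - a)"
  proof -
    have "c\<^sup>2 = c powr 2" using assms by simp
    moreover have "2 * (- ((1 + a) / 2)) = - 1 - a" by (simp add: field_simps)
    ultimately show ?thesis by (metis powr_powr)
  qed
  also have "Gamma ((1 - a) / 2) * Gamma ((1 + a) / 2) = pi / cos (pi * a / 2)"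
  proof -
    have "complex_of_real (Gamma ((1 + a) / 2) * Gamma (1 - (1 + a) / 2)) =
            of_real (pi / sin (pi * ((1 + a) / 2)))"
      using Gamma_reflection_complex[of "of_real ((1 + a) / 2)"]
      by (simp add: Gamma_complex_of_real[symmetric] sin_of_real[symmetric])
    hence "Gamma ((1 + a) / 2) * Gamma (1 - (1 + a) / 2) = pi / sin (pi * ((1 + a) / 2))"
      by (simp only: of_real_eq_iff)
    also have "sin (pi * ((1 + a) / 2)) = cos (pi * a / 2)"
      by (simp add: sin_cos_eq field_simps)
    also have "1 - (1 + a) / 2 = (1 - a) / 2" by (simp add: field_simps)
    finally show ?thesis by (simp add: mult.commute)
  qed
  finally show ?thesis by (simp add: mult_ac)
qed

section \<open>The trapezoidal rule with its Peano kernel\<close>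

lemma trapezoid_has_integral:
  fixes f F f' f'' :: "real \<Rightarrow> 'a :: banach" and b :: real
  assumes "\<And>v. v \<in> {b<..<b+1} \<Longrightarrow> (F has_vector_derivative f v) (at v)"
    and "\<And>v. v \<in> {b<..<b+1} \<Longrightarrow> (f has_vector_derivative f' v) (at v)"
    and "\<And>v. v \<in> {b<..<b+1} \<Longrightarrow> (f' has_vector_derivative f'' v) (at v)"
    and "continuous_on {b..b+1} F" "continuous_on {b..b+1} f"
    and "continuous_on {b..b+1} (\<lambda>v. ((v - b) * (b + 1 - v) / 2) *\<^sub>R f' v)"
  shows "((\<lambda>v. ((v - b) * (b + 1 - v) / 2) *\<^sub>R f'' v) has_integral
           (1 / 2) *\<^sub>R (f b + f (b + 1)) - (F (b + 1) - F b)) {b..b+1}"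
proof -
  \<comment> \<open>The kernel \<open>(v - b) * (b + 1 - v) / 2\<close> vanishes at both ends and
    has slopes 1/2 and -1/2 there, so integrating \<open>f''\<close> against it by parts twice
    leaves the trapezoid minus the integral. \<open>G\<close> is the resulting
    antiderivative.\<close>
  define G where "G = (\<lambda>v. ((v - b) * (b + 1 - v) / 2) *\<^sub>R f' v - ((2 * b + 1 - 2 * v) / 2) *\<^sub>R f v - F v)"
  have "((\<lambda>v. ((v - b) * (b + 1 - v) / 2) *\<^sub>R f'' v) has_integral (G (b + 1) - G b)) {b..b+1}"
  proof (rule fundamental_theorem_of_calculus_interior)
    show "continuous_on {b..b+1} G"
      unfolding G_def by (intro continuous_on_diff assms) (intro continuous_intros assms; simp)
    fix v assume v: "v \<in> {b<..<b+1}"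
    show "(G has_vector_derivative ((v - b) * (b + 1 - v) / 2) *\<^sub>R f'' v) (at v)"
    proof -
      have 1: "((\<lambda>v. (v - b) * (b + 1 - v) / 2) has_real_derivative (2 * b + 1 - 2 * v) / 2) (at v)"
        by (auto intro!: derivative_eq_intros simp: field_simps)
      have 2: "((\<lambda>v. (2 * b + 1 - 2 * v) / 2) has_real_derivative - 1) (at v)"
        by (auto intro!: derivative_eq_intros)
      note assms' = assms(1-3)[OF v]
      show ?thesis unfolding G_def
        using has_vector_derivative_diff[OF has_vector_derivative_diff[OF
          has_vector_derivative_scaleR[OF 1 assms'(3)] has_vector_derivative_scaleR[OF 2 assms'(2)]] assms'(1)]
        by simp
    qed
  qed simp
  moreover have "G (b + 1) - G b = (1 / 2) *\<^sub>R (f b + f (b + 1)) - (F (b + 1) - F b)"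
    by (simp add: G_def algebra_simps)
  ultimately show ?thesis by simp
qed

section \<open>Partial fractions of the cotangent and the hyperbolic cotangent\<close>

lemma Digamma_reflection:
  fixes z :: complex
  assumes "z \<notin> \<int>"
  shows "Digamma (1 - z) - Digamma z = pi * cot (pi * z)"
proof -
  have z: "z \<notin> \<int>\<^sub>\<le>\<^sub>0" "1 - z \<notin> \<int>\<^sub>\<le>\<^sub>0" "1 - z \<notin> \<int>"
    using assms nonpos_Ints_Int Ints_diff[of 1 "1 - z"] by auto
  have s: "sin (of_real pi * z) \<noteq> 0"
    using assms sin_eq_0[of "of_real pi * z"] by auto
  \<comment> \<open>Both sides of the reflection formula for Gamma are differentiated; dividing by
    the function itself gives the logarithmic derivative.\<close>
  have "((\<lambda>z. Gamma z * Gamma (1 - z)) has_field_derivative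
          Gamma z * Gamma (1 - z) * (Digamma z - Digamma (1 - z))) (at z)"
    using z by (auto intro!: derivative_eq_intros simp: algebra_simps)
  moreover have "((\<lambda>z. pi / sin (pi * z)) has_field_derivative
          - (pi * cos (pi * z) * pi) / (sin (pi * z))\<^sup>2) (at z)"
    using s by (auto intro!: derivative_eq_intros simp: power2_eq_square)
  hence "((\<lambda>z. Gamma z * Gamma (1 - z)) has_field_derivative
          - (pi * cos (pi * z) * pi) / (sin (pi * z))\<^sup>2) (at z)"
    by (simp add: Gamma_reflection_complex)
  ultimately have "Gamma z * Gamma (1 - z) * (Digamma z - Digamma (1 - z)) =
          - (pi * cos (pi * z) * pi) / (sin (pi * z))\<^sup>2"
    by (rule DERIV_unique)
  hence "pi / sin (pi * z) * (Digamma z - Digamma (1 - z)) = - (pi * cos (pi * z) * pi) / (sin (pi * z))\<^sup>2"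
    by (simp only: Gamma_reflection_complex)
  hence "sin (pi * z) / pi * (pi / sin (pi * z) * (Digamma z - Digamma (1 - z))) =
           sin (pi * z) / pi * (- (pi * cos (pi * z) * pi) / (sin (pi * z))\<^sup>2)"
    by (rule arg_cong)
  hence "Digamma z - Digamma (1 - z) = - (pi * cos (pi * z)) / sin (pi * z)"
    using s by (simp add: power2_eq_square)
  thus ?thesis
    by (simp add: cot_def algebra_simps)
qed

text \<open>The limit formula for Digamma expresses the cotangent through the sums of 1/(z + n) and
  1/(1 - z + n). Pairing index n + 1 of the first with index n of the second gives the terms of the
  series; what remains is the head 1/z and a boundary term tending to 0.\<close>

lemma cot_partial_fractions:
  fixes z :: complex
  assumes "z \<notin> \<int>"
  shows "(\<lambda>n. 2 * z / (z\<^sup>2 - of_nat (Suc n) ^ 2)) sums (pi * cot (pi * z) - 1 / z)"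
proof -
  have nz: "z + of_nat n \<noteq> 0" "1 - z + of_nat n \<noteq> 0" "z - of_nat n \<noteq> 0" for n
    using assms by (auto simp: add_eq_0_iff2 algebra_simps)
  define S where "S = (\<lambda>m. (\<Sum>n<m. inverse (z + of_nat n)) - (\<Sum>n<m. inverse (1 - z + of_nat n)))"
  have "(\<lambda>m. (of_real (ln (real m)) - (\<Sum>n<m. inverse (1 - z + of_nat n))) -
             (of_real (ln (real m)) - (\<Sum>n<m. inverse (z + of_nat n))))
           \<longlonglongrightarrow> Digamma (1 - z) - Digamma z"
    using nz[of 0] by (intro tendsto_diff Digamma_LIMSEQ) auto
  hence S: "S \<longlonglongrightarrow> pi * cot (pi * z)"
    using assms by (simp add: S_def Digamma_reflection)
  have "(\<lambda>m. inverse (z + of_nat m)) \<longlonglongrightarrow> 0"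
    by (intro tendsto_inverse_0[THEN filterlim_compose] tendsto_add_filterlim_at_infinity[OF tendsto_const]
        tendsto_of_nat)
  hence "(\<lambda>m. S m - 1 / z + inverse (z + of_nat m)) \<longlonglongrightarrow> pi * cot (pi * z) - 1 / z + 0"
    by (intro tendsto_intros S)
  moreover have "S m - 1 / z + inverse (z + of_nat m) = (\<Sum>n<m. 2 * z / (z\<^sup>2 - of_nat (Suc n) ^ 2))" for m
  proof (induction m)
    case (Suc m)
    have "2 * z / (z\<^sup>2 - of_nat (Suc m) ^ 2) = inverse (z + of_nat (Suc m)) - inverse (1 - z + of_nat m)"
    proof -
      have "z\<^sup>2 - of_nat (Suc m) ^ 2 = (z + of_nat (Suc m)) * (z - of_nat (Suc m))"
        by (simp add: algebra_simps power2_eq_square)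
      moreover have "1 - z + of_nat m = - (z - of_nat (Suc m))" by simp
      moreover have "2 * z / ((z + k) * (z - k)) = inverse (z + k) - inverse (- (z - k))"
        if "z + k \<noteq> 0" "z - k \<noteq> 0" for k
        unfolding inverse_minus_eq using that by (simp add: divide_simps)
      ultimately show ?thesis
        using nz(1,3)[of "Suc m"] by (simp only: not_False_eq_True)
    qed
    with Suc.IH show ?case by (simp add: S_def algebra_simps)
  qed (simp add: S_def inverse_eq_divide)
  ultimately show ?thesis by (simp add: sums_def)
qed

text \<open>The value is coth(x/2)/2 - 1/x, kept in terms of \<open>exp (- x)\<close> because it
  will be met as the sum of a geometric series with that ratio. It is the cotangent expansion at z =
  ix/(2 pi).\<close>

lemma coth_partial_fractions:
  fixes x :: real
  assumes "x > 0"
  shows "(\<lambda>k. 2 * x / (x\<^sup>2 + (2 * pi * real (Suc k))\<^sup>2)) sums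
           ((1 + exp (- x)) / (2 * (1 - exp (- x))) - 1 / x)"
proof -
  define z where "z = \<i> * of_real (x / (2 * pi))"
  have z: "z \<notin> \<int>"
    using assms by (auto simp: z_def Ints_def complex_eq_iff)
  have "(\<lambda>n. \<i> / (2 * pi) * (2 * z / (z\<^sup>2 - of_nat (Suc n) ^ 2))) sums (\<i> / (2 * pi) * (pi * cot (pi * z) - 1 / z))"
    by (intro sums_mult cot_partial_fractions z)
  also have "(\<lambda>n. \<i> / (2 * pi) * (2 * z / (z\<^sup>2 - of_nat (Suc n) ^ 2))) =
             (\<lambda>n. of_real (2 * x / (x\<^sup>2 + (2 * pi * real (Suc n))\<^sup>2)))"
  proof
    fix n
    define A where "A = x\<^sup>2 + (2 * pi * real (Suc n))\<^sup>2"
    define B where "B = (x / (2 * pi))\<^sup>2 + (real (Suc n))\<^sup>2"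
    have "A > 0" using assms unfolding A_def by (intro add_pos_nonneg) auto
    have "B = A / (2 * pi)\<^sup>2"
      by (simp add: A_def B_def power_divide power_mult_distrib add_divide_distrib del: of_nat_Suc)
    hence "x / (2 * pi * pi) / B = 2 * x / A"
      using \<open>A > 0\<close> by (simp add: power2_eq_square)
    moreover have "z\<^sup>2 - of_nat (Suc n) ^ 2 = - of_real B"
      by (simp add: z_def B_def power_mult_distrib power_divide del: of_nat_Suc)
    hence "\<i> / (2 * pi) * (2 * z / (z\<^sup>2 - of_nat (Suc n) ^ 2)) = of_real (x / (2 * pi * pi) / B)"
      by (simp add: z_def del: of_nat_Suc)
    ultimately show "\<i> / (2 * pi) * (2 * z / (z\<^sup>2 - of_nat (Suc n) ^ 2)) = of_real (2 * x / (x\<^sup>2 + (2 * pi * real (Suc n))\<^sup>2))"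
      by (simp add: A_def)
  qed
  also have "\<i> / (2 * pi) * (pi * cot (pi * z) - 1 / z) = of_real ((1 + exp (- x)) / (2 * (1 - exp (- x))) - 1 / x)"
  proof -
    have pz: "of_real pi * z = \<i> * of_real (x / 2)" by (simp add: z_def)
    define e where "e = exp (x / 2)"
    have e: "e > 1" using assms by (simp add: e_def)
    have "exp (- x) = inverse e ^ 2"
      by (simp add: e_def exp_minus[symmetric] exp_double[symmetric])
    moreover have "cot (of_real pi * z) = - \<i> * of_real ((e + inverse e) / (e - inverse e))"
    proof -
      have "cos (of_real pi * z) = of_real ((e + inverse e) / 2)"
        unfolding pz cos_exp_eq e_def by (simp add: exp_minus exp_of_real[symmetric] field_simps)
      moreover have "sin (of_real pi * z) = \<i> * of_real ((e - inverse e) / 2)"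
        unfolding pz sin_exp_eq e_def by (simp add: exp_minus exp_of_real[symmetric] field_simps)
      ultimately have "cot (of_real pi * z) = of_real ((e + inverse e) / 2) / (\<i> * of_real ((e - inverse e) / 2))"
        by (simp only: cot_def)
      also have "\<dots> = - \<i> * of_real (((e + inverse e) / 2) / ((e - inverse e) / 2))"
      proof -
        have "of_real u / (\<i> * of_real w) = - \<i> * of_real (u / w)" for u w
          by (cases "w = 0") (simp_all add: field_simps)
        thus ?thesis .
      qed
      also have "(u / 2) / (w / 2) = u / w" for u w :: real by simp
      finally show ?thesis .
    qed
    moreover have "(e + inverse e) / (e - inverse e) = (1 + inverse e ^ 2) / (1 - inverse e ^ 2)"
    proof -
      have "1 + inverse e ^ 2 = inverse e * (e + inverse e)" "1 - inverse e ^ 2 = inverse e * (e - inverse e)"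
        using e by (simp_all add: distrib_left right_diff_distrib power2_eq_square)
      thus ?thesis using e by simp
    qed
    moreover have "\<i> / (2 * pi) * (pi * (- \<i> * of_real q) - 1 / z) = of_real (q / 2 - 1 / x)" for q
      using assms by (simp add: z_def right_diff_distrib)
    moreover have "(1 + w) / (2 * (1 - w)) = (1 + w) / (1 - w) / 2" for w :: real by simp
    ultimately show ?thesis by (simp only:)
  qed
  finally show ?thesis by (simp only: sums_of_real_iff)
qed

section \<open>Trapezoidal errors of real powers and their sum\<close>

definition trapezoid_error :: "real \<Rightarrow> nat \<Rightarrow> real" where
  "trapezoid_error a n = (real (Suc n) powr (a + 1) - real n powr (a + 1)) / (a + 1) -
                         (real n powr a + real (Suc n) powr a) / 2"

text \<open>The kernel formula is applied to \<open>- (v powr a)\<close>: the sign turns trapezoid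
  minus integral into \<open>trapezoid_error\<close>, and it makes the integrand nonnegative when a
  < 1.\<close>

lemma trapezoid_powr_has_integral:
  assumes "a > 0"
  shows "((\<lambda>v. (v - real n) * (real n + 1 - v) / 2 * (a * (1 - a) * v powr (a - 2))) has_integral
           trapezoid_error a n) {real n..real n + 1}"
proof -
  have "((\<lambda>v. ((v - real n) * (real n + 1 - v) / 2) *\<^sub>R (a * (1 - a) * v powr (a - 2))) has_integral
      (1 / 2) *\<^sub>R (- (real n powr a) + - ((real n + 1) powr a)) -
      (- ((real n + 1) powr (a + 1) / (a + 1)) - - (real n powr (a + 1) / (a + 1)))) {real n..real n + 1}"
  proof (rule trapezoid_has_integral[where f' = "\<lambda>v. - (a * v powr (a - 1))"])
    fix v assume "v \<in> {real n<..<real n + 1}"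
    hence v: "v > 0" by (simp add: le_less_trans[of 0 "real n"])
    show "((\<lambda>v. - (v powr (a + 1) / (a + 1))) has_vector_derivative - (v powr a)) (at v)"
      unfolding has_real_derivative_iff_has_vector_derivative[symmetric]
      using v assms
      by (intro DERIV_cong[OF DERIV_minus[OF DERIV_cdivide[OF has_real_derivative_powr]]]) auto
    show "((\<lambda>v. - (v powr a)) has_vector_derivative - (a * v powr (a - 1))) (at v)"
         "((\<lambda>v. - (a * v powr (a - 1))) has_vector_derivative a * (1 - a) * v powr (a - 2)) (at v)"
      unfolding has_real_derivative_iff_has_vector_derivative[symmetric]
      using v assms by (auto intro!: derivative_eq_intros simp: field_simps)
  next
    show "continuous_on {real n..real n + 1} (\<lambda>v. - (v powr (a + 1) / (a + 1)))"
         "continuous_on {real n..real n + 1} (\<lambda>v. - (v powr a))"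
      using assms by (intro continuous_intros continuous_on_powr'; force)+
    show "continuous_on {real n..real n + 1} (\<lambda>v. ((v - real n) * (real n + 1 - v) / 2) *\<^sub>R - (a * v powr (a - 1)))"
    \<comment> \<open>For \<open>n = 0\<close> the derivative is singular at 0, but the factor
      \<open>v\<close> of the kernel turns \<open>v powr (a - 1)\<close> into
      \<open>v powr a\<close>.\<close>
    proof (cases "n = 0")
      case True
      have "continuous_on {real n..real n + 1} (\<lambda>v. - ((real n + 1 - v) / 2 * a * v powr a))"
        using assms by (intro continuous_intros continuous_on_powr'; force)
      moreover have "((v - real n) * (real n + 1 - v) / 2) *\<^sub>R - (a * v powr (a - 1)) =
          - ((real n + 1 - v) / 2 * a * v powr a)" if "v \<in> {real n..real n + 1}" for v
      proof -
        have "v * v powr (a - 1) = v powr a"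
          using that by (cases "v = 0") (auto simp: powr_diff)
        thus ?thesis using True by (simp add: field_simps)
      qed
      ultimately show ?thesis by (subst continuous_on_cong[OF refl]) auto
    next
      case False
      thus ?thesis by (intro continuous_intros; force)
    qed
  qed
  also have "(1 / 2) *\<^sub>R (- x + - y) - (- (u / (a + 1)) - - (w / (a + 1))) =
             (u - w) / (a + 1) - (x + y) / 2" for x y u w
    by (simp add: diff_divide_distrib add_divide_distrib)
  finally show ?thesis
    by (simp add: trapezoid_error_def add.commute)
qed

lemma trapezoid_exp_has_integral:
  fixes b x :: real
  assumes "x > 0"
  shows "((\<lambda>v. (v - b) * (b + 1 - v) / 2 * exp (- v * x)) has_integral
           exp (- b * x) * ((1 + exp (- x)) / 2 - (1 - exp (- x)) / x) / x\<^sup>2) {b..b + 1}"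
proof -
  have "((\<lambda>v. ((v - b) * (b + 1 - v) / 2) *\<^sub>R exp (- v * x)) has_integral
      (1 / 2) *\<^sub>R (exp (- b * x) / x\<^sup>2 + exp (- (b + 1) * x) / x\<^sup>2) -
      (- exp (- (b + 1) * x) / x ^ 3 - - exp (- b * x) / x ^ 3)) {b..b + 1}"
  proof (rule trapezoid_has_integral[where f' = "\<lambda>v. - exp (- v * x) / x"])
    fix v
    show "((\<lambda>v. - exp (- v * x) / x ^ 3) has_vector_derivative exp (- v * x) / x\<^sup>2) (at v)"
         "((\<lambda>v. exp (- v * x) / x\<^sup>2) has_vector_derivative - exp (- v * x) / x) (at v)"
         "((\<lambda>v. - exp (- v * x) / x) has_vector_derivative exp (- v * x)) (at v)"
      unfolding has_real_derivative_iff_has_vector_derivative[symmetric]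
      using assms by (auto intro!: derivative_eq_intros simp: field_simps power2_eq_square power3_eq_cube)
  qed (use assms in \<open>auto intro!: continuous_intros\<close>)
  also have "exp (- (b + 1) * x) = exp (- b * x) * exp (- x)"
    by (simp add: exp_add[symmetric] algebra_simps)
  also have "(1 / 2) *\<^sub>R (e / x\<^sup>2 + e * f / x\<^sup>2) - (- (e * f) / x ^ 3 - - e / x ^ 3) =
             e * ((1 + f) / 2 - (1 - f) / x) / x\<^sup>2" for e f
    using assms by (simp add: field_simps power2_eq_square power3_eq_cube)
  finally show ?thesis by simp
qed

text \<open>Up to the factor \<open>Gamma (2 - a)\<close>, the power \<open>v powr (a - 2)\<close>
  is the integral of \<open>x powr (1 - a) * exp (- v * x)\<close> over x. Inserting this into the
  kernel formula and exchanging the integrals leaves the kernel integral of an exponential.\<close>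

lemma nn_integral_trapezoid_error:
  assumes "0 < a" "a < 1"
  shows "(\<integral>\<^sup>+x\<in>{0<..}. ennreal (x powr (-1 - a)) *
             ennreal (exp (- real n * x) * ((1 + exp (- x)) / 2 - (1 - exp (- x)) / x)) \<partial>lborel) =
           ennreal (Gamma (2 - a) / (a * (1 - a)) * trapezoid_error a n)"
proof -
  define p where "p = (\<lambda>v. (v - real n) * (real n + 1 - v) / 2)"
  define E where "E = (\<lambda>x. exp (- real n * x) * ((1 + exp (- x)) / 2 - (1 - exp (- x)) / x))"
  have p: "p v \<ge> 0" if "v \<in> {real n..real n+1}" for v
    using that by (auto simp: p_def)
  have [measurable]: "p \<in> borel_measurable borel" "E \<in> borel_measurable borel"
    by (simp_all add: p_def E_def)
  define h :: "real \<Rightarrow> real \<Rightarrow> ennreal" where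
    "h = (\<lambda>x v. ennreal (x powr (1 - a) * exp (- v * x)) * indicator {0<..} x *
               (ennreal (p v) * indicator {real n..real n + 1} v))"
  have 1: "(\<integral>\<^sup>+v. h x v \<partial>lborel) = ennreal (x powr (-1 - a)) * ennreal (E x) * indicator {0<..} x" for x
  proof (cases "x > 0")
    case True
    have "(\<integral>\<^sup>+v. h x v \<partial>lborel) = (\<integral>\<^sup>+v. ennreal (x powr (1 - a)) *
              (ennreal (p v * exp (- v * x)) * indicator {real n..real n+1} v) \<partial>lborel)"
      using True p by (intro nn_integral_cong) (auto simp: h_def indicator_def ennreal_mult mult_ac)
    also have "\<dots> = ennreal (x powr (1 - a)) * ennreal (E x / x\<^sup>2)"
      unfolding E_def p_def using True
      by (subst nn_integral_cmult, measurable, subst nn_integral_has_integral_lebesgue'[OF _ trapezoid_exp_has_integral]) auto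
    also have "\<dots> = ennreal (x powr (1 - a) * (E x / x\<^sup>2))"
      by (simp add: ennreal_mult'[symmetric])
    also have "x powr (1 - a) * (E x / x\<^sup>2) = x powr (-1 - a) * E x"
    proof -
      have "x powr (1 - a) = x powr (-1 - a) * x powr 2" by (simp add: powr_add[symmetric])
      thus ?thesis using True by simp
    qed
    finally show ?thesis using True by (simp add: ennreal_mult')
  qed (auto simp: h_def)
  have 2: "(\<integral>\<^sup>+x. h x v \<partial>lborel) = ennreal (Gamma (2 - a) / (a * (1 - a))) *
             (ennreal (p v * (a * (1 - a) * v powr (a - 2))) * indicator {real n..real n + 1} v)" for v
  proof (cases "v \<in> {real n..real n+1} \<and> v > 0")
    case True
    have "(\<integral>\<^sup>+x. h x v \<partial>lborel) = (\<integral>\<^sup>+x. ennreal (p v) *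
             (ennreal (x powr (1 * (2 - a) - 1) * exp (- v * x powr 1)) * indicator {0<..} x) \<partial>lborel)"
      using True by (intro nn_integral_cong) (auto simp: h_def indicator_def ennreal_mult[symmetric] mult_ac)
    also have "\<dots> = ennreal (p v) * ennreal (Gamma (2 - a) * v powr (- (2 - a)) / 1)"
      using assms True by (subst nn_integral_cmult, measurable, subst nn_integral_Gamma_powr) auto
    also have "\<dots> = ennreal (Gamma (2 - a) / (a * (1 - a))) * ennreal (p v * (a * (1 - a) * v powr (a - 2)))"
      using assms True p[of v] by (simp add: ennreal_mult[symmetric])
    finally show ?thesis using True by simp
  next
    case False
    \<comment> \<open>The only point of an interval with \<open>v \<le> 0\<close> is
      \<open>v = 0\<close> for \<open>n = 0\<close>. The Gamma integral diverges there, but the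
      kernel vanishes.\<close>
    hence "p v = 0 \<or> v \<notin> {real n..real n+1}" by (auto simp: p_def)
    thus ?thesis by (auto simp: h_def)
  qed
  have "(\<integral>\<^sup>+x. \<integral>\<^sup>+v. h x v \<partial>lborel \<partial>lborel) = (\<integral>\<^sup>+v. \<integral>\<^sup>+x. h x v \<partial>lborel \<partial>lborel)"
    by (rule lborel_pair.Fubini'[symmetric]) (unfold h_def, measurable)
  also have "\<dots> = ennreal (Gamma (2 - a) / (a * (1 - a))) * ennreal (trapezoid_error a n)"
  proof -
    have eq: "(\<integral>\<^sup>+v\<in>{real n..real n+1}. ennreal (p v * (a * (1 - a) * v powr (a - 2))) \<partial>lborel) =
            ennreal (trapezoid_error a n)"
      using assms trapezoid_powr_has_integral[of a n] unfolding p_def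
      by (intro nn_integral_has_integral_lebesgue') auto
    show ?thesis unfolding 2 by (subst nn_integral_cmult, measurable, subst eq, rule refl)
  qed
  also have "\<dots> = ennreal (Gamma (2 - a) / (a * (1 - a)) * trapezoid_error a n)"
    using assms by (intro ennreal_mult'[symmetric] divide_nonneg_pos) auto
  finally show ?thesis by (simp add: 1 E_def mult_ac)
qed

lemma trapezoid_error_nonneg:
  assumes "0 < a" "a < 1"
  shows "trapezoid_error a n \<ge> 0"
  using assms by (intro has_integral_nonneg[OF trapezoid_powr_has_integral]) auto

text \<open>Under the integral the sum over n is geometric and turns into partial fractions indexed
  by k; integrated one by one they give the powers of \<open>2 * pi * k\<close>, so the right-hand
  side is zeta(1 + a) up to an explicit factor. In \<open>ennreal\<close> the exchange is free, and
  finiteness of the result yields summability of the errors.\<close>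

lemma trapezoid_error_sums:
  assumes "0 < a" "a < 1"
  shows "trapezoid_error a sums
           (a * (1 - a) * pi / (Gamma (2 - a) * cos (pi * a / 2)) * (\<Sum>k. (2 * pi * real (Suc k)) powr (- 1 - a)))"
proof -
  define E where "E = (\<lambda>x. (1 + exp (- x)) / 2 - (1 - exp (- x)) / x :: real)"
  define G where "G = Gamma (2 - a) / (a * (1 - a))"
  have "G > 0" using assms by (auto simp: G_def)
  have "cos (pi * a / 2) > 0"
    using assms by (intro cos_gt_zero) (auto simp: field_simps)
  have [measurable]: "E \<in> borel_measurable borel" by (simp add: E_def)
  have E: "E x \<ge> 0" if "x > 0" for x
  proof -
    \<comment> \<open>With \<open>b = 0\<close> the kernel integral of the exponential is a positive
      multiple of \<open>E x\<close>.\<close>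
    have "0 \<le> exp (- 0 * x) * E x / x\<^sup>2"
      unfolding E_def using that by (intro has_integral_nonneg[OF trapezoid_exp_has_integral]) auto
    thus ?thesis using that by (simp add: field_simps)
  qed
  have summ: "summable (\<lambda>k. (2 * pi * real (Suc k)) powr (- 1 - a))"
  proof -
    have "summable (\<lambda>k. real (Suc k) powr (- 1 - a))"
      using summable_Suc_iff[of "\<lambda>k. real k powr (-1 - a)"] assms by (simp add: summable_real_powr_iff)
    thus ?thesis by (simp add: powr_mult summable_mult del: of_nat_Suc)
  qed
  have geom: "(\<Sum>n. ennreal (exp (- real n * x) * E x)) =
      (\<Sum>k. ennreal (2 * x / (x\<^sup>2 + (2 * pi * real (Suc k))\<^sup>2)))" if x: "x > 0" for x
  proof -
    have "(\<lambda>n. exp (- x) ^ n * E x) sums (1 / (1 - exp (- x)) * E x)"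
      using x by (intro sums_mult2 geometric_sums) auto
    also have "(\<lambda>n. exp (- x) ^ n * E x) = (\<lambda>n. exp (- real n * x) * E x)"
      by (simp add: exp_of_nat_mult[symmetric])
    also have "1 / (1 - exp (- x)) * E x = (1 + exp (- x)) / (2 * (1 - exp (- x))) - 1 / x"
    proof -
      have eq: "1 / d * (u / 2 - d / x) = u / (2 * d) - 1 / x" if "d \<noteq> 0" for d u
        using that by (simp add: right_diff_distrib)
      show ?thesis unfolding E_def by (rule eq) (use x in simp)
    qed
    finally have "(\<lambda>n. exp (- real n * x) * E x) sums \<dots>" .
    with coth_partial_fractions[OF x] show ?thesis
      using x E[OF x] by (subst (1 2) suminf_ennreal_eq) (auto simp: add_nonneg_nonneg)
  qed
  have "(\<Sum>n. ennreal (G * trapezoid_error a n)) =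
      (\<Sum>n. \<integral>\<^sup>+x. ennreal (x powr (-1 - a)) * ennreal (exp (- real n * x) * E x) * indicator {0<..} x \<partial>lborel)"
    unfolding G_def E_def using assms by (subst nn_integral_trapezoid_error) auto
  also have "\<dots> = (\<integral>\<^sup>+x. (\<Sum>n. ennreal (x powr (-1 - a)) * ennreal (exp (- real n * x) * E x) * indicator {0<..} x) \<partial>lborel)"
    by (rule nn_integral_suminf[symmetric]) measurable
  also have "\<dots> = (\<integral>\<^sup>+x. (\<Sum>k. 2 * (ennreal (x powr (- a) / (x\<^sup>2 + (2 * pi * real (Suc k))\<^sup>2)) * indicator {0<..} x)) \<partial>lborel)"
  proof (intro nn_integral_cong)
    fix x :: real
    show "(\<Sum>n. ennreal (x powr (-1 - a)) * ennreal (exp (- real n * x) * E x) * indicator {0<..} x) =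
       (\<Sum>k. 2 * (ennreal (x powr (- a) / (x\<^sup>2 + (2 * pi * real (Suc k))\<^sup>2)) * indicator {0<..} x))"
    proof (cases "x > 0")
      case True
      have "x powr (- a) = x powr (-1 - a) * x"
        using True by (simp add: powr_diff powr_minus field_simps)
      hence "2 * ennreal (x powr (- a) / (x\<^sup>2 + (2 * pi * real (Suc k))\<^sup>2)) =
             ennreal (x powr (-1 - a)) * ennreal (2 * x / (x\<^sup>2 + (2 * pi * real (Suc k))\<^sup>2))" for k
        using True by (simp add: ennreal_mult'[symmetric] ennreal_numeral[symmetric] mult_ac del: ennreal_numeral of_nat_Suc)
      thus ?thesis using True geom[OF True] by (simp add: ennreal_suminf_cmult del: of_nat_Suc)
    qed simp
  qed
  also have "\<dots> = (\<Sum>k. 2 * ennreal (pi / (2 * cos (pi * a / 2)) * (2 * pi * real (Suc k)) powr (- 1 - a)))"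
    using assms by (subst nn_integral_suminf, measurable, subst nn_integral_cmult, measurable,
        subst nn_integral_powr_over_square) auto
  also have "\<dots> = (\<Sum>k. ennreal (pi / cos (pi * a / 2) * (2 * pi * real (Suc k)) powr (- 1 - a)))"
    using \<open>cos (pi * a / 2) > 0\<close>
    by (intro suminf_cong) (simp add: ennreal_mult'[symmetric] ennreal_numeral[symmetric] del: ennreal_numeral of_nat_Suc)
  also have "\<dots> = ennreal (\<Sum>k. pi / cos (pi * a / 2) * (2 * pi * real (Suc k)) powr (- 1 - a))"
    using \<open>cos (pi * a / 2) > 0\<close> summ by (intro suminf_ennreal2 summable_mult) auto
  also have "(\<Sum>k. pi / cos (pi * a / 2) * (2 * pi * real (Suc k)) powr (- 1 - a)) =
             pi / cos (pi * a / 2) * (\<Sum>k. (2 * pi * real (Suc k)) powr (- 1 - a))"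
    by (intro suminf_mult summ)
  finally have eq: "(\<Sum>n. ennreal (G * trapezoid_error a n)) =
      ennreal (pi / cos (pi * a / 2) * (\<Sum>k. (2 * pi * real (Suc k)) powr (- 1 - a)))" .
  have nonneg: "G * trapezoid_error a n \<ge> 0" for n
    using \<open>G > 0\<close> trapezoid_error_nonneg[OF assms] by simp
  have "summable (\<lambda>n. G * trapezoid_error a n)"
    using eq nonneg by (intro summable_suminf_not_top) auto
  moreover from this eq nonneg
  have "(\<Sum>n. G * trapezoid_error a n) = pi / cos (pi * a / 2) * (\<Sum>k. (2 * pi * real (Suc k)) powr (- 1 - a))"
    using \<open>cos (pi * a / 2) > 0\<close> summ
    by (simp add: suminf_ennreal2 suminf_nonneg)
  ultimately have "(\<lambda>n. G * trapezoid_error a n) sums (pi / cos (pi * a / 2) * (\<Sum>k. (2 * pi * real (Suc k)) powr (- 1 - a)))"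
    by (metis summable_sums)
  hence "(\<lambda>n. inverse G * (G * trapezoid_error a n)) sums
           (inverse G * (pi / cos (pi * a / 2) * (\<Sum>k. (2 * pi * real (Suc k)) powr (- 1 - a))))"
    by (rule sums_mult)
  thus ?thesis using \<open>G > 0\<close>
    by (simp add: mult.assoc[symmetric]) (simp add: G_def field_simps)
qed

section \<open>Analytic continuation and functional equation\<close>

text \<open>This is \<open>s - 1\<close> times the trapezoid minus the integral of
  \<open>v powr (- s)\<close> from n + 1 to n + 2. The factor \<open>s - 1\<close> clears the
  denominator of the antiderivative, so each term is entire.\<close>

definition zeta_term :: "nat \<Rightarrow> complex \<Rightarrow> complex" where
  "zeta_term n s = (s - 1) * ((of_nat (Suc n) powr (- s) + of_nat (Suc (Suc n)) powr (- s)) / 2) +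
                   of_nat (Suc (Suc n)) powr (1 - s) - of_nat (Suc n) powr (1 - s)"

text \<open>Stands for (s - 1) zeta(s). Of the summand \<open>(s + 1) / 2\<close>, the part 1 comes
  from the integral of \<open>v powr (- s)\<close> over v \<ge> 1 and the part (s - 1)/2 from the
  half weight of the first term, both multiplied by s - 1.\<close>

definition zeta_reg :: "complex \<Rightarrow> complex" where
  "zeta_reg s = (s + 1) / 2 + (\<Sum>n. zeta_term n s)"

lemma summable_Suc_powr:
  assumes "c < - 1"
  shows "summable (\<lambda>n. real (Suc n) powr c)"
  using assms summable_Suc_iff[of "\<lambda>n. real n powr c"] by (simp add: summable_real_powr_iff)

text \<open>The kernel formula brings in the second derivative of \<open>v powr (- s)\<close>, which
  decays two powers faster than the function; this is what carries convergence to Re s > -1. For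
  \<open>Re s \<ge> - 2\<close> its modulus is nonincreasing in v, so the left endpoint bounds
  it.\<close>

lemma norm_zeta_term_le:
  assumes "Re s \<ge> - 2"
  shows "norm (zeta_term n s) \<le> norm (s - 1) * norm (s * (s + 1)) * real (Suc n) powr (- Re s - 2)"
proof (cases "s = 1")
  case False
  define b where "b = real (Suc n)"
  have "b > 0" by (simp add: b_def)
  define f where "f = (\<lambda>v. complex_of_real v powr (- s))"
  define F where "F = (\<lambda>v. complex_of_real v powr (1 - s) / (1 - s))"
  define f' where "f' = (\<lambda>v. - s * complex_of_real v powr (- s - 1))"
  define f'' where "f'' = (\<lambda>v. s * (s + 1) * complex_of_real v powr (- s - 2))"
  define I where "I = (1 / 2) *\<^sub>R (f b + f (b + 1)) - (F (b + 1) - F b)"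
  have deriv: "((\<lambda>v. complex_of_real v powr c) has_vector_derivative c * of_real v powr (c - 1)) (at v)"
    if "v > 0" for v c
    using that by (intro has_vector_derivative_real_field) (auto intro!: derivative_eq_intros)
  have "((\<lambda>v. ((v - b) * (b + 1 - v) / 2) *\<^sub>R f'' v) has_integral I) {b..b + 1}"
    unfolding I_def
  proof (rule trapezoid_has_integral[where f' = f'])
    fix v assume "v \<in> {b<..<b + 1}"
    hence "v > 0" using \<open>b > 0\<close> by simp
    note deriv = deriv[OF this]
    show "(F has_vector_derivative f v) (at v)"
      using has_vector_derivative_divide[OF deriv[of "1 - s"], of "1 - s"] False by (simp add: F_def f_def)
    show "(f has_vector_derivative f' v) (at v)"
      using deriv[of "- s"] by (simp add: f_def f'_def)
    show "(f' has_vector_derivative f'' v) (at v)"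
      using has_vector_derivative_mult_right[OF deriv[of "- s - 1"], of "- s"]
      by (simp add: f'_def f''_def algebra_simps)
  qed (use \<open>b > 0\<close> False in \<open>auto simp: F_def f_def f'_def intro!: continuous_intros\<close>)
  moreover have "norm (((v - b) * (b + 1 - v) / 2) *\<^sub>R f'' v) \<le> norm (s * (s + 1)) * b powr (- Re s - 2)"
    if v: "v \<in> {b..b + 1}" for v
  proof -
    have "v > 0" using v \<open>b > 0\<close> by simp
    have "(v - b) * (b + 1 - v) \<le> 1 * 1" using v by (intro mult_mono) auto
    moreover have "(v - b) * (b + 1 - v) \<ge> 0" using v by (intro mult_nonneg_nonneg) auto
    ultimately have "\<bar>(v - b) * (b + 1 - v) / 2\<bar> \<le> 1" by (simp add: abs_le_iff)
    moreover have "norm (f'' v) = norm (s * (s + 1)) * v powr (- Re s - 2)"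
      using \<open>v > 0\<close> by (simp add: f''_def norm_mult norm_powr_real_powr)
    moreover have "v powr (- Re s - 2) \<le> b powr (- Re s - 2)"
      using assms v \<open>b > 0\<close> by (intro powr_mono2') auto
    ultimately have "\<bar>(v - b) * (b + 1 - v) / 2\<bar> * norm (f'' v) \<le> 1 * (norm (s * (s + 1)) * b powr (- Re s - 2))"
      by (intro mult_mono) (auto intro: mult_left_mono)
    thus ?thesis by simp
  qed
  ultimately have "norm I \<le> norm (s * (s + 1)) * b powr (- Re s - 2) * measure lborel {b..b + 1}"
    by (intro has_integral_bound_real) auto
  hence "norm I \<le> norm (s * (s + 1)) * b powr (- Re s - 2)" by simp
  moreover have "zeta_term n s = (s - 1) * I"
  proof -
    have 1: "(s - 1) * (u / (1 - s)) = - u" for u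
      using False by (simp add: field_simps)
    have 2: "of_nat (Suc n) = complex_of_real b" "of_nat (Suc (Suc n)) = complex_of_real (b + 1)"
      by (simp_all add: b_def)
    have "(s - 1) * I = (s - 1) * ((f b + f (b + 1)) / 2) - ((s - 1) * F (b + 1) - (s - 1) * F b)"
      by (simp add: I_def scaleR_conv_of_real right_diff_distrib)
    also have "\<dots> = zeta_term n s"
      unfolding F_def 1 by (simp add: zeta_term_def 2 f_def del: of_real_add of_nat_Suc)
    finally show ?thesis ..
  qed
  ultimately show ?thesis
    by (simp add: norm_mult b_def mult.assoc mult_left_mono)
qed (simp add: zeta_term_def del: of_nat_Suc)

lemma summable_zeta_term:
  assumes "Re s > - 1"
  shows "summable (\<lambda>n. zeta_term n s)"
proof (rule summable_norm_cancel, rule summable_comparison_test)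
  show "\<exists>N. \<forall>n\<ge>N. norm (norm (zeta_term n s)) \<le>
          norm (s - 1) * norm (s * (s + 1)) * real (Suc n) powr (- Re s - 2)"
    using norm_zeta_term_le[of s] assms by auto
  show "summable (\<lambda>n. norm (s - 1) * norm (s * (s + 1)) * real (Suc n) powr (- Re s - 2))"
    using assms by (intro summable_mult summable_Suc_powr) auto
qed

lemma holomorphic_zeta_reg: "zeta_reg holomorphic_on {s. Re s > - 1}"
proof (rule holomorphic_uniform_sequence)
  show "open {s. Re s > - 1}" by (rule open_halfspace_Re_gt)
  show "(\<lambda>s. (s + 1) / 2 + (\<Sum>n<N. zeta_term n s)) holomorphic_on {s. Re s > - 1}" for N
    unfolding zeta_term_def by (intro holomorphic_intros) auto
  fix x assume x: "x \<in> {s. Re s > - 1}"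
  \<comment> \<open>Half the distance to the boundary line Re s = -1, so that Re s \<ge> d - 1 on
    the whole closed disc.\<close>
  define d where "d = (Re x + 1) / 2"
  define K where "K = (norm x + d + 1)"
  have "d > 0" using x by (simp add: d_def)
  have Re: "Re s \<ge> d - 1" if "s \<in> cball x d" for s
  proof -
    have "Re x - Re s \<le> norm (x - s)" using complex_Re_le_cmod[of "x - s"] by simp
    also have "\<dots> \<le> d" using that by (simp add: dist_norm)
    finally show ?thesis by (simp add: d_def field_simps)
  qed
  have "cball x d \<subseteq> {s. Re s > - 1}" using Re \<open>d > 0\<close> by force
  moreover have "uniform_limit (cball x d) (\<lambda>N s. \<Sum>n<N. zeta_term n s) (\<lambda>s. \<Sum>n. zeta_term n s) sequentially"
  proof (rule Weierstrass_m_test)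
    show "summable (\<lambda>n. K * (K * K) * real (Suc n) powr (- d - 1))"
      using \<open>d > 0\<close> by (intro summable_mult summable_Suc_powr) auto
    fix n s assume s: "s \<in> cball x d"
    have "norm s \<le> norm x + d"
      using s norm_triangle_ineq2[of s x] by (simp add: dist_norm norm_minus_commute)
    hence "norm (s - 1) \<le> K" "norm s \<le> K" "norm (s + 1) \<le> K"
      using norm_triangle_ineq4[of s 1] norm_triangle_ineq[of s 1] by (auto simp: K_def)
    moreover have "K \<ge> 0" using \<open>d > 0\<close> by (simp add: K_def)
    moreover have "real (Suc n) powr (- Re s - 2) \<le> real (Suc n) powr (- d - 1)"
      using Re[OF s] by (intro powr_mono) auto
    ultimately have "norm (s - 1) * norm (s * (s + 1)) * real (Suc n) powr (- Re s - 2) \<le>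
        K * (K * K) * real (Suc n) powr (- d - 1)"
      unfolding norm_mult by (intro mult_mono) auto
    moreover have "norm (zeta_term n s) \<le> norm (s - 1) * norm (s * (s + 1)) * real (Suc n) powr (- Re s - 2)"
      using Re[OF s] \<open>d > 0\<close> by (intro norm_zeta_term_le) auto
    ultimately show "norm (zeta_term n s) \<le> K * (K * K) * real (Suc n) powr (- d - 1)"
      by linarith
  qed
  hence "uniform_limit (cball x d) (\<lambda>N s. (s + 1) / 2 + (\<Sum>n<N. zeta_term n s)) zeta_reg sequentially"
    unfolding zeta_reg_def[abs_def] by (intro uniform_limit_intros)
  ultimately show "\<exists>d>0. cball x d \<subseteq> {s. Re s > - 1} \<and>
      uniform_limit (cball x d) (\<lambda>N s. (s + 1) / 2 + (\<Sum>n<N. zeta_term n s)) zeta_reg sequentially"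
    using \<open>d > 0\<close> by blast
qed

text \<open>The bound on a term contains three factors linear in s, whence the cube. Staying 1/2
  away from the boundary line makes the series of exponent -3/2 a uniform majorant.\<close>

lemma norm_zeta_reg_le:
  obtains C where "C > 0" "\<And>s. Re s \<ge> - 1 / 2 \<Longrightarrow> norm (zeta_reg s) \<le> C * (1 + norm s) ^ 3"
proof
  define S where "S = (\<Sum>n. real (Suc n) powr (- 3 / 2))"
  have summ: "summable (\<lambda>n. real (Suc n) powr (- 3 / 2))"
    by (rule summable_Suc_powr) simp
  have "S \<ge> 0" unfolding S_def by (intro suminf_nonneg summ) auto
  thus "S + 1 > 0" by simp
  fix s :: complex assume s: "Re s \<ge> - 1 / 2"
  define K where "K = 1 + norm s"
  have K: "norm (s - 1) \<le> K" "norm s \<le> K" "norm (s + 1) \<le> K" "K \<ge> 1"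
    using norm_triangle_ineq4[of s 1] norm_triangle_ineq[of s 1] by (auto simp: K_def)
  have *: "norm (zeta_term n s) \<le> K ^ 3 * real (Suc n) powr (- 3 / 2)" for n
  proof -
    have "norm (zeta_term n s) \<le> norm (s - 1) * norm (s * (s + 1)) * real (Suc n) powr (- Re s - 2)"
      using s by (intro norm_zeta_term_le) auto
    also have "\<dots> \<le> (K * (K * K)) * real (Suc n) powr (- 3 / 2)"
      unfolding norm_mult using K s by (intro mult_mono powr_mono) (auto simp: field_simps)
    finally show ?thesis by (simp add: power3_eq_cube mult.assoc)
  qed
  have "norm (\<Sum>n. zeta_term n s) \<le> (\<Sum>n. K ^ 3 * real (Suc n) powr (- 3 / 2))"
    by (intro norm_suminf_le * summable_mult summ)
  also have "\<dots> = K ^ 3 * S"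
    unfolding S_def by (intro suminf_mult summ)
  finally have "norm (\<Sum>n. zeta_term n s) \<le> K ^ 3 * S" .
  moreover have "norm ((s + 1) / 2) \<le> K ^ 3"
  proof -
    have "norm ((s + 1) / 2) \<le> K" using K by (simp add: norm_divide)
    also have "K \<le> K ^ 3" using K(4) by (intro self_le_power) auto
    finally show ?thesis .
  qed
  ultimately show "norm (zeta_reg s) \<le> (S + 1) * (1 + norm s) ^ 3"
    using norm_triangle_ineq[of "(s + 1) / 2" "\<Sum>n. zeta_term n s"]
    by (simp add: zeta_reg_def K_def algebra_simps)
qed

lemma zeta_series_sums:
  assumes "Re s > 1"
  shows "(\<lambda>n. 1 / of_nat (Suc n) powr s) sums (zeta_reg s / (s - 1))"
proof -
  define a where "a = (\<lambda>n. of_nat (Suc n) powr (- s) :: complex)"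
  define b where "b = (\<lambda>n. of_nat (Suc n) powr (1 - s) :: complex)"
  have "s \<noteq> 1" using assms by auto
  have lim: "(\<lambda>n. of_nat (Suc n) powr c) \<longlonglongrightarrow> (0 :: complex)" if "Re c < 0" for c
  proof (rule tendsto_norm_zero_cancel)
    have "(\<lambda>n. real (Suc n) powr (Re c)) \<longlonglongrightarrow> 0"
      using that by (intro tendsto_neg_powr filterlim_compose[OF filterlim_real_sequentially] filterlim_Suc)
    moreover have "norm (of_nat (Suc n) powr c :: complex) = real (Suc n) powr Re c" for n
      by (subst norm_powr_real_powr) (auto simp del: of_nat_Suc)
    ultimately show "(\<lambda>n. norm (of_nat (Suc n) powr c :: complex)) \<longlonglongrightarrow> 0"
      by (simp only:)
  qed
  have "a \<longlonglongrightarrow> 0" "b \<longlonglongrightarrow> 0"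
    unfolding a_def b_def using assms by (intro lim; simp)+
  \<comment> \<open>The powers \<open>b\<close> telescope, and the trapezoids count the interior
    terms fully and the two end terms by half.\<close>
  have part: "(\<Sum>n<N. zeta_term n s) = (s - 1) * ((\<Sum>n<N. a n) - (1 - a N) / 2) + b N - 1" for N
  proof (induction N)
    case (Suc N)
    have zt: "zeta_term N s = (s - 1) * ((a N + a (Suc N)) / 2) + b (Suc N) - b N"
      by (simp add: zeta_term_def a_def b_def)
    show ?case unfolding sum.lessThan_Suc Suc.IH zt by (simp add: field_simps)
  qed (simp add: a_def b_def)
  have "(\<Sum>n<N. a n) = ((\<Sum>n<N. zeta_term n s) - b N + 1) / (s - 1) + (1 - a N) / 2" for N
    unfolding part using \<open>s \<noteq> 1\<close> by (simp add: field_simps)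
  moreover have "(\<lambda>N. ((\<Sum>n<N. zeta_term n s) - b N + 1) / (s - 1) + (1 - a N) / 2)
      \<longlonglongrightarrow> ((\<Sum>n. zeta_term n s) - 0 + 1) / (s - 1) + (1 - 0) / 2"
    using assms \<open>s \<noteq> 1\<close> by (intro tendsto_intros \<open>a \<longlonglongrightarrow> 0\<close> \<open>b \<longlonglongrightarrow> 0\<close> summable_LIMSEQ summable_zeta_term) auto
  moreover have "((\<Sum>n. zeta_term n s) - 0 + 1) / (s - 1) + (1 - 0) / 2 = zeta_reg s / (s - 1)"
    using \<open>s \<noteq> 1\<close> by (simp add: zeta_reg_def field_simps)
  ultimately have "a sums (zeta_reg s / (s - 1))" by (simp add: sums_def)
  thus ?thesis by (simp add: a_def powr_minus divide_inverse)
qed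

text \<open>The trapezoidal rule is exact on constants, so every term vanishes at 0. The value keeps
  0 out of the nontrivial zeros and witnesses that the function is not identically zero.\<close>

lemma zeta_reg_0: "zeta_reg 0 = 1 / 2"
  by (simp add: zeta_reg_def zeta_term_def del: of_nat_Suc) simp

section \<open>The functional equation, with the classical factor chi(s) = 2^s pi^(s-1) sin(pi s/2)
  Gamma(1-s)\<close>

definition zeta_factor :: "complex \<Rightarrow> complex" where
  "zeta_factor s = 2 * of_real (2 * pi) powr (s - 1) * sin (of_real pi * s / 2) * Gamma (1 - s)"

text \<open>The series of \<open>zeta_term\<close> begins with the interval from 1 to 2. At s = -a
  the summand \<open>(s + 1) / 2\<close> is \<open>a + 1\<close> times the error on the interval
  from 0 to 1, so it supplies exactly the missing index 0.\<close>

lemma zeta_reg_minus: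
  assumes "0 < a" "a < 1"
  shows "zeta_reg (- of_real a) = of_real ((a + 1) * suminf (trapezoid_error a))"
proof -
  have sums: "summable (trapezoid_error a)"
    using trapezoid_error_sums[OF assms] by (rule sums_summable)
  have term_eq: "zeta_term n (- of_real a) = of_real ((a + 1) * trapezoid_error a (Suc n))" for n
  proof -
    have eq: "of_nat (Suc m) powr complex_of_real c = of_real (real (Suc m) powr c)" for m c
      using powr_of_real[of "real (Suc m)" c] by (simp del: of_nat_Suc)
    have "zeta_term n (- of_real a) = (- of_real a - 1) *
        ((of_nat (Suc n) powr of_real a + of_nat (Suc (Suc n)) powr of_real a) / 2) +
        of_nat (Suc (Suc n)) powr of_real (a + 1) - of_nat (Suc n) powr of_real (a + 1)"
      by (simp add: zeta_term_def add.commute del: of_nat_Suc)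
    also have "\<dots> = of_real ((- a - 1) * ((real (Suc n) powr a + real (Suc (Suc n)) powr a) / 2) +
        real (Suc (Suc n)) powr (a + 1) - real (Suc n) powr (a + 1))"
      unfolding eq by simp
    also have "(- a - 1) * ((real (Suc n) powr a + real (Suc (Suc n)) powr a) / 2) +
        real (Suc (Suc n)) powr (a + 1) - real (Suc n) powr (a + 1) = (a + 1) * trapezoid_error a (Suc n)"
    proof -
      have "(- a - 1) * ((u + w) / 2) + x - y = (a + 1) * ((x - y) / (a + 1) - (u + w) / 2)" for u w x y
        using assms by (simp add: field_simps)
      thus ?thesis by (simp only: trapezoid_error_def)
    qed
    finally show ?thesis .
  qed
  have "zeta_reg (- of_real a) = of_real ((1 - a) / 2) + (\<Sum>n. of_real ((a + 1) * trapezoid_error a (Suc n)))"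
    unfolding zeta_reg_def term_eq by simp
  also have "(\<Sum>n. complex_of_real ((a + 1) * trapezoid_error a (Suc n))) =
             of_real (\<Sum>n. (a + 1) * trapezoid_error a (Suc n))"
    using sums by (intro suminf_of_real[symmetric] summable_mult) (subst summable_Suc_iff)
  also have "(\<Sum>n. (a + 1) * trapezoid_error a (Suc n)) = (a + 1) * (\<Sum>n. trapezoid_error a (Suc n))"
    using sums by (intro suminf_mult) (subst summable_Suc_iff)
  also have "(\<Sum>n. trapezoid_error a (Suc n)) = suminf (trapezoid_error a) - trapezoid_error a 0"
    using suminf_split_head[OF sums] .
  also have "of_real ((1 - a) / 2) + complex_of_real ((a + 1) * (suminf (trapezoid_error a) - trapezoid_error a 0)) =
        of_real ((1 - a) / 2 + (a + 1) * (suminf (trapezoid_error a) - trapezoid_error a 0))"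
    by simp
  also have "(a + 1) * trapezoid_error a 0 = (1 - a) / 2"
    using assms by (simp add: trapezoid_error_def field_simps)
  hence "(1 - a) / 2 + (a + 1) * (suminf (trapezoid_error a) - trapezoid_error a 0) =
           (a + 1) * suminf (trapezoid_error a)"
    by (simp add: right_diff_distrib)
  finally show ?thesis .
qed

lemma zeta_reg_one_plus:
  assumes "a > 0"
  shows "zeta_reg (1 + of_real a) =
           of_real (a * (2 * pi) powr (1 + a) * (\<Sum>k. (2 * pi * real (Suc k)) powr (- 1 - a)))"
proof -
  have "(\<lambda>n. 1 / of_nat (Suc n) powr (1 + complex_of_real a)) sums (zeta_reg (1 + of_real a) / of_real a)"
    using zeta_series_sums[of "1 + of_real a"] assms by simp
  moreover have "1 / of_nat (Suc n) powr (1 + complex_of_real a) = of_real (real (Suc n) powr (- 1 - a))" for n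
  proof -
    have "of_nat (Suc n) powr (1 + complex_of_real a) = of_real (real (Suc n) powr (1 + a))"
      using powr_of_real[of "real (Suc n)" "1 + a"] by (simp del: of_nat_Suc)
    moreover have "real (Suc n) powr (- 1 - a) = 1 / real (Suc n) powr (1 + a)"
      using powr_minus_divide[of "real (Suc n)" "1 + a"] by simp
    ultimately show ?thesis by (simp del: of_nat_Suc)
  qed
  ultimately have "(\<lambda>n. complex_of_real (real (Suc n) powr (- 1 - a))) sums (zeta_reg (1 + of_real a) / of_real a)"
    by (simp only:)
  moreover have summ: "summable (\<lambda>n. real (Suc n) powr (- 1 - a))"
    using assms by (intro summable_Suc_powr) auto
  hence "(\<lambda>n. complex_of_real (real (Suc n) powr (- 1 - a))) sums of_real (\<Sum>n. real (Suc n) powr (- 1 - a))"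
    by (intro sums_of_real summable_sums)
  ultimately have "zeta_reg (1 + of_real a) / of_real a = of_real (\<Sum>n. real (Suc n) powr (- 1 - a))"
    by (rule sums_unique2)
  hence "zeta_reg (1 + of_real a) = of_real (a * (\<Sum>n. real (Suc n) powr (- 1 - a)))"
    using assms by (simp add: field_simps)
  also have "(\<Sum>n. real (Suc n) powr (- 1 - a)) =
      (2 * pi) powr (1 + a) * (\<Sum>k. (2 * pi * real (Suc k)) powr (- 1 - a))"
  proof -
    have "(\<Sum>k. (2 * pi * real (Suc k)) powr (- 1 - a)) = (2 * pi) powr (- 1 - a) * (\<Sum>k. real (Suc k) powr (- 1 - a))"
      using summ by (simp add: powr_mult suminf_mult del: of_nat_Suc)
    moreover have "(2 * pi) powr (1 + a) * (2 * pi) powr (- 1 - a) = 1"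
      by (simp add: powr_add[symmetric])
    ultimately show ?thesis by (simp add: mult.assoc[symmetric])
  qed
  finally show ?thesis by (simp add: mult.assoc)
qed

text \<open>The values at -a and at 1 + a are multiples of the same series \<open>S\<close>.
  Matching the factors uses the recurrence of Gamma, its reflection formula at a, and the doubling
  formula for the sine.\<close>

lemma zeta_functional_equation_real:
  assumes "0 < a" "a < 1"
  shows "of_real a * zeta_reg (- of_real a) =
           - (1 + of_real a) * zeta_factor (- of_real a) * zeta_reg (1 + of_real a)"
proof -
  define S where "S = (\<Sum>k. (2 * pi * real (Suc k)) powr (- 1 - a))"
  define c where "c = cos (pi * a / 2)"
  define s where "s = sin (pi * a / 2)"
  define G where "G = Gamma (1 - a)"
  define P where "P = (2 * pi) powr (1 + a)"
  have pos: "c > 0" "s > 0" "G > 0" "P > 0"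
    unfolding c_def s_def G_def P_def using assms
    by (auto intro!: cos_gt_zero sin_gt_zero simp: field_simps)
  have G2: "Gamma (2 - a) = (1 - a) * G"
    using Gamma_plus1[of "1 - a"] Gamma_real_pos[of "1 - a"] Gamma_eq_zero_iff[of "1 - a"] assms
    by (auto simp: G_def)
  have "complex_of_real (Gamma a * G) = of_real (pi / sin (pi * a))"
    using Gamma_reflection_complex[of "of_real a"]
    by (simp add: Gamma_complex_of_real[symmetric] sin_of_real[symmetric] G_def)
  hence refl: "Gamma a * G = pi / sin (pi * a)"
    by (simp only: of_real_eq_iff)
  also have "sin (pi * a) = 2 * s * c"
    using sin_double[of "pi * a / 2"] by (simp add: s_def c_def)
  finally have "Gamma a = pi / (2 * s * c * G)"
    using pos by (simp add: field_simps)
  hence Ga: "Gamma (1 + a) = a * (pi / (2 * s * c * G))"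
    using Gamma_plus1[of a] Gamma_real_pos[of a] Gamma_eq_zero_iff[of a] assms
    by (auto simp: add.commute)
  have zf: "zeta_factor (- of_real a) = of_real (2 / P * - s * Gamma (1 + a))"
  proof -
    have 1: "of_real (2 * pi) powr (- complex_of_real a - 1) = of_real (inverse P)"
    proof -
      have "(2 * pi) powr (- a - 1) = inverse P"
        unfolding P_def powr_minus[symmetric] by (rule arg_cong[where f = "\<lambda>t. (2 * pi) powr t"]) simp
      thus ?thesis using powr_of_real[of "2 * pi" "- a - 1"] by simp
    qed
    have 2: "sin (of_real pi * (- of_real a) / 2) = complex_of_real (- s)"
      by (simp add: s_def sin_of_real[symmetric])
    have 3: "Gamma (1 - - complex_of_real a) = of_real (Gamma (1 + a))"
      using Gamma_complex_of_real[of "1 + a"] by simp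
    show ?thesis unfolding zeta_factor_def 1 2 3 by (simp add: divide_inverse)
  qed
  have tz: "suminf (trapezoid_error a) = a * (1 - a) * pi / (Gamma (2 - a) * c) * S"
    using trapezoid_error_sums[OF assms] by (simp add: sums_iff S_def c_def)
  have zp: "zeta_reg (1 + of_real a) = of_real (a * P * S)"
    using zeta_reg_one_plus[OF assms(1)] by (simp add: P_def S_def)
  have "a * ((a + 1) * (a * (1 - a) * pi / ((1 - a) * G * c) * S)) =
      (1 + a) * (2 / P * s * (a * (pi / (2 * s * c * G)))) * (a * P * S)"
    using pos assms by (simp, simp add: algebra_simps)
  hence eq: "a * ((a + 1) * (a * (1 - a) * pi / ((1 - a) * G * c) * S)) =
      - (1 + a) * (2 / P * - s * (a * (pi / (2 * s * c * G)))) * (a * P * S)"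
    by (simp only: mult_minus_left mult_minus_right minus_minus)
  have conv: "of_real a * of_real x = - (1 + of_real a) * of_real y * complex_of_real z"
    if "a * x = - (1 + a) * y * z" for x y z
  proof -
    have "complex_of_real (a * x) = of_real (- (1 + a) * y * z)" by (simp only: that)
    thus ?thesis by simp
  qed
  show ?thesis
    unfolding zeta_reg_minus[OF assms] zf tz zp G2 Ga by (rule conv[OF eq])
qed

lemma not_nonpos_Int_if_Re_pos: "Re z > 0 \<Longrightarrow> z \<notin> \<int>\<^sub>\<le>\<^sub>0"
  by (auto elim!: nonpos_Ints_cases)

lemma holomorphic_zeta_factor: "zeta_factor holomorphic_on {s. Re s < 1}"
  unfolding zeta_factor_def
  by (intro holomorphic_intros not_nonpos_Int_if_Re_pos) auto

lemma zeta_factor_nonzero: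
  assumes "\<bar>Re s\<bar> < 1" "s \<noteq> 0"
  shows "zeta_factor s \<noteq> 0"
proof -
  have "sin (of_real pi * s / 2) \<noteq> 0"
  proof
    assume "sin (of_real pi * s / 2) = 0"
    then obtain n :: int where "of_real pi * s / 2 = of_real (of_int n * pi)"
      unfolding sin_eq_0 by auto
    hence "s = 2 * of_int n" by (simp add: field_simps)
    with assms show False by auto
  qed
  moreover have "1 - s \<notin> \<int>\<^sub>\<le>\<^sub>0"
    using assms by (intro not_nonpos_Int_if_Re_pos) auto
  ultimately show ?thesis
    by (simp add: zeta_factor_def Gamma_eq_zero_iff)
qed

text \<open>Identity theorem on the strip, starting from the real segment between -1 and 0, which
  accumulates at -1/2. The denominators are cleared because zeta(1 - s) has a pole at s = 0, inside
  the strip.\<close>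

lemma zeta_reg_functional_equation:
  assumes "\<bar>Re s\<bar> < 1"
  shows "s * zeta_reg s = (1 - s) * zeta_factor s * zeta_reg (1 - s)"
proof -
  define S where "S = {s. \<bar>Re s\<bar> < 1}"
  define f where "f = (\<lambda>s. s * zeta_reg s - (1 - s) * zeta_factor s * zeta_reg (1 - s))"
  have S: "S = {s. Re s > - 1} \<inter> {s. Re s < 1}" by (auto simp: S_def)
  have "open S" unfolding S by (intro open_Int open_halfspace_Re_gt open_halfspace_Re_lt)
  moreover have "connected S" unfolding S
    by (intro convex_connected convex_Int convex_halfspace_Re_gt convex_halfspace_Re_lt)
  moreover have "f holomorphic_on S"
  proof -
    have "zeta_reg holomorphic_on S" "zeta_factor holomorphic_on S"
      by (rule holomorphic_on_subset[OF holomorphic_zeta_reg] holomorphic_on_subset[OF holomorphic_zeta_factor];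
          auto simp: S_def)+
    moreover have "(\<lambda>s. zeta_reg (1 - s)) holomorphic_on S"
      using holomorphic_on_compose_gen[of "\<lambda>s. 1 - s" S zeta_reg "{s. Re s > - 1}"] holomorphic_zeta_reg
      by (force simp: S_def o_def intro: holomorphic_intros)
    ultimately show ?thesis unfolding f_def by (intro holomorphic_intros)
  qed
  moreover define U where "U = (\<lambda>a. - complex_of_real a) ` {0<..<1}"
  have "U \<subseteq> S" by (auto simp: U_def S_def)
  moreover have "- of_real (1 / 2) \<in> S" by (simp add: S_def)
  moreover have "- of_real (1 / 2) islimpt U"
  proof -
    have "(1 / 2 :: real) islimpt {0<..<1}" by (intro open_imp_islimpt) auto
    moreover have "eventually (\<lambda>a. - complex_of_real a \<noteq> - of_real (1 / 2)) (at (1 / 2))"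
      using eventually_neq_at_within[of "1 / 2 :: real"]
      by eventually_elim (simp only: neg_equal_iff_equal of_real_eq_iff simp_thms)
    ultimately show ?thesis
      unfolding U_def by (intro islimpt_isCont_image) (auto intro!: continuous_intros)
  qed
  moreover have "f z = 0" if "z \<in> U" for z
  proof -
    obtain a where a: "z = - of_real a" "0 < a" "a < 1" using \<open>z \<in> U\<close> by (auto simp: U_def)
    have "f z = - (of_real a * zeta_reg (- of_real a)) - (1 + of_real a) * zeta_factor (- of_real a) * zeta_reg (1 + of_real a)"
      by (simp add: f_def a(1))
    also have "\<dots> = 0" unfolding zeta_functional_equation_real[OF a(2,3)] by (simp add: algebra_simps)
    finally show ?thesis .
  qed
  moreover have "s \<in> S" using assms by (simp add: S_def)
  ultimately have "f s = 0"
    by (blast intro: analytic_continuation[of f S U "- of_real (1 / 2)"])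
  thus ?thesis by (simp add: f_def)
qed

section \<open>The continuation to the punctured plane and its uniqueness\<close>

definition zeta_ext :: "complex \<Rightarrow> complex" where
  "zeta_ext s = (if s = 1 then 0
                 else if Re s > - 1 then zeta_reg s / (s - 1)
                 else zeta_factor s * zeta_reg (1 - s) / (- s))"

text \<open>On the strip -1 < Re s < 1 the two formulas of \<open>zeta_ext\<close> agree by the
  functional equation. This overlap is what glues them to a holomorphic function.\<close>

lemma zeta_ext_left:
  assumes "Re s < 1" "s \<noteq> 0"
  shows "zeta_ext s = zeta_factor s * zeta_reg (1 - s) / (- s)"
proof (cases "Re s > - 1")
  case True
  have "s \<noteq> 1" using assms by auto
  have "s * zeta_reg s = (1 - s) * zeta_factor s * zeta_reg (1 - s)"
    using True assms by (intro zeta_reg_functional_equation) auto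
  hence "zeta_reg s / (s - 1) = zeta_factor s * zeta_reg (1 - s) / (- s)"
    using \<open>s \<noteq> 1\<close> assms by (simp add: divide_simps) (simp add: algebra_simps)
  thus ?thesis using True \<open>s \<noteq> 1\<close> by (simp add: zeta_ext_def)
qed (use assms in \<open>auto simp: zeta_ext_def\<close>)

lemma holomorphic_zeta_ext: "zeta_ext holomorphic_on - {1}"
proof -
  have "(\<lambda>s. zeta_reg s / (s - 1)) holomorphic_on {s. Re s > - 1} - {1}"
    by (intro holomorphic_intros holomorphic_on_subset[OF holomorphic_zeta_reg]) auto
  hence 1: "zeta_ext holomorphic_on {s. Re s > - 1} - {1}"
    by (rule holomorphic_transform) (auto simp: zeta_ext_def)
  have "(zeta_reg \<circ> (\<lambda>s. 1 - s)) holomorphic_on {s. Re s < 0}"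
    by (intro holomorphic_on_compose_gen[OF _ holomorphic_zeta_reg] holomorphic_intros) auto
  hence "(\<lambda>s. zeta_factor s * zeta_reg (1 - s) / (- s)) holomorphic_on {s. Re s < 0}"
    unfolding o_def
    by (intro holomorphic_intros holomorphic_on_subset[OF holomorphic_zeta_factor]) auto
  hence 2: "zeta_ext holomorphic_on {s. Re s < 0}"
    by (rule holomorphic_transform) (subst zeta_ext_left, auto)
  have "zeta_ext holomorphic_on ({s. Re s > - 1} - {1}) \<union> {s. Re s < 0}"
    using 1 2 by (intro holomorphic_on_Un open_Diff open_halfspace_Re_gt open_halfspace_Re_lt) auto
  moreover have "({s. Re s > - 1} - {1}) \<union> {s. Re s < 0} = - {1}"
    by auto
  ultimately show ?thesis by simp
qed

text \<open>Uniqueness is the identity theorem on the punctured plane, which is connected, together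
  with the prescribed value at 1. From here on the explicit formulas are available for
  \<open>zeta\<close>.\<close>

lemma zeta_eq_zeta_ext: "zeta = zeta_ext"
  unfolding zeta_def
proof (rule the_equality)
  show "zeta_ext holomorphic_on - {1} \<and> zeta_ext 1 = 0 \<and>
      (\<forall>s. 1 < Re s \<longrightarrow> (\<lambda>n. 1 / of_nat (Suc n) powr s) sums zeta_ext s)"
    using holomorphic_zeta_ext zeta_series_sums by (auto simp: zeta_ext_def)
  then have sums: "(\<lambda>n. 1 / of_nat (Suc n) powr s) sums zeta_ext s" if "Re s > 1" for s
    using that by blast
  fix f
  assume f: "f holomorphic_on - {1} \<and> f 1 = 0 \<and>
      (\<forall>s. 1 < Re s \<longrightarrow> (\<lambda>n. 1 / of_nat (Suc n) powr s) sums f s)"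
  have "f s = zeta_ext s" if "s \<noteq> 1" for s
  proof (rule analytic_continuation_open[of "{s. Re s > 1}" "- {1}" f zeta_ext])
    show "open {s. Re s > 1}" by (rule open_halfspace_Re_gt)
    have "2 \<in> {s. Re s > 1}" by simp
    thus "{s. Re s > 1} \<noteq> {}" by blast
    show "connected (- {1 :: complex})"
      by (rule connected_punctured_universe) simp
    show "f z = zeta_ext z" if "z \<in> {s. Re s > 1}" for z
      using that f sums sums_unique2 by blast
  qed (use that f holomorphic_zeta_ext in auto)
  thus "f = zeta_ext"
    using f by (metis ext zeta_ext_def)
qed

lemma holomorphic_zeta: "zeta holomorphic_on - {1}"
  by (simp add: zeta_eq_zeta_ext holomorphic_zeta_ext)

lemma zeta_sums: "Re s > 1 \<Longrightarrow> (\<lambda>n. 1 / of_nat (Suc n) powr s) sums zeta s"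
  using zeta_series_sums[of s] by (auto simp: zeta_eq_zeta_ext zeta_ext_def)

lemma zeta_eq: "Re s > - 1 \<Longrightarrow> s \<noteq> 1 \<Longrightarrow> zeta s = zeta_reg s / (s - 1)"
  by (simp add: zeta_eq_zeta_ext zeta_ext_def)

lemma zeta_0: "zeta 0 = - 1 / 2"
  by (simp add: zeta_eq zeta_reg_0)

lemma zeta_functional_equation:
  assumes "Re s < 1" "s \<noteq> 0"
  shows "zeta s = zeta_factor s * zeta (1 - s)"
proof -
  have "zeta (1 - s) = zeta_reg (1 - s) / (- s)"
    using zeta_eq[of "1 - s"] assms by simp
  moreover have "zeta s = zeta_factor s * zeta_reg (1 - s) / (- s)"
    unfolding zeta_eq_zeta_ext using assms by (rule zeta_ext_left)
  ultimately show ?thesis by simp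
qed

text \<open>The sum of \<open>n\<^sup>-\<^sup>s\<close> over the integers without prime factors up to \<open>N\<close> is a multiple
  of \<open>zeta s\<close>, yet it tends to 1 as \<open>N\<close> grows.\<close>
lemma zeta_nonzero_right:
  assumes s: "Re s > 1"
  shows "zeta s \<noteq> 0"
proof
  assume zero: "zeta s = 0"
  define f where "f = (\<lambda>n. of_nat n powr (- s) :: complex)"
  define A where "A = (\<lambda>N. {n::nat. n > 0 \<and> (\<forall>p. prime p \<and> p \<le> N \<longrightarrow> \<not> p dvd n)})"
  have norm_f: "norm (f (Suc n)) = real (Suc n) powr (- Re s)" for n
    unfolding f_def by (subst norm_powr_real_powr) (auto simp del: of_nat_Suc)
  have summ: "summable (\<lambda>n. norm (f (Suc n)))"
    unfolding norm_f using s by (intro summable_Suc_powr) auto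
  have f_mult: "f (p * n) = f p * f n" for p n
    unfolding f_def of_nat_mult by (rule powr_times_real) auto
  have "(f has_sum 0) (A N)" for N
  proof (induction N)
    case 0
    have "(\<lambda>n. f (Suc n)) sums 0"
      using zeta_sums[OF s] zero by (simp add: f_def powr_minus divide_inverse)
    hence "((f \<circ> Suc) has_sum 0) UNIV"
      unfolding o_def by (rule norm_summable_imp_has_sum[OF summ])
    hence "(f has_sum 0) (range Suc)"
      by (subst has_sum_reindex) auto
    moreover have "range Suc = A 0"
      by (auto simp: A_def image_iff gr0_conv_Suc dest: prime_gt_0_nat)
    ultimately show ?case by simp
  next
    case (Suc N)
    show ?case
    proof (cases "prime (Suc N)")
      case True
      define p where "p = Suc N"
      have p: "prime p" "p > 0" using True by (auto simp: p_def)
      have inj: "inj_on ((*) p) (A N)" using p by (auto simp: inj_on_def)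
      have "((\<lambda>n. f p * f n) has_sum f p * 0) (A N)"
        by (intro has_sum_cmult_right Suc.IH)
      hence "(f has_sum 0) ((*) p ` A N)"
        using inj by (subst has_sum_reindex) (auto simp: o_def f_mult)
      moreover have sub: "(*) p ` A N \<subseteq> A N"
      proof safe
        fix n assume n: "n \<in> A N"
        have "\<not> q dvd p * n" if "prime q" "q \<le> N" for q
        proof
          assume "q dvd p * n"
          hence "q dvd p \<or> q dvd n" using that prime_dvd_mult_iff by blast
          moreover have "\<not> q dvd p"
            using that p primes_dvd_imp_eq[of q p] by (auto simp: p_def)
          ultimately show False using n that by (auto simp: A_def)
        qed
        thus "p * n \<in> A N" using n p by (auto simp: A_def)
      qed
      moreover have "A (Suc N) = A N - (*) p ` A N"
      proof (intro equalityI subsetI)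
        fix n assume n: "n \<in> A (Suc N)"
        hence "\<not> p dvd n" using p by (simp add: A_def p_def)
        hence "n \<notin> (*) p ` A N" by auto
        thus "n \<in> A N - (*) p ` A N" using n by (auto simp: A_def)
      next
        fix n assume n: "n \<in> A N - (*) p ` A N"
        have "\<not> p dvd n"
        proof
          assume "p dvd n"
          then obtain k where k: "n = p * k" by blast
          hence "k \<in> A N" using n by (auto simp: A_def)
          thus False using n k by blast
        qed
        thus "n \<in> A (Suc N)" using n by (auto simp: A_def p_def le_Suc_eq)
      qed
      ultimately show ?thesis
        using has_sum_Diff[OF Suc.IH] by fastforce
    next
      case False
      hence "A (Suc N) = A N" by (auto simp: A_def le_Suc_eq)
      thus ?thesis using Suc.IH by simp
    qed
  qed
  note sieve = this
  obtain N where N: "\<And>n. n \<ge> N \<Longrightarrow> norm (\<Sum>i. norm (f (Suc (i + n)))) < 1 / 2"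
    using suminf_exist_split[OF _ summ, of "1 / 2"] by auto
  have "1 \<in> A N" by (auto simp: A_def)
  \<comment> \<open>Removing n = 1, whose term is 1, leaves the sum -1. A remaining number has a
    prime factor, which exceeds N, so the sum is bounded by a tail smaller than 1/2.\<close>
  hence "(f has_sum 0 - f 1) (A N - {1})"
    by (intro has_sum_Diff sieve) (auto simp: has_sum_finite_iff)
  hence lim: "(sum f \<longlongrightarrow> - 1) (finite_subsets_at_top (A N - {1}))"
    by (simp add: has_sum_def f_def)
  have "norm (- 1 :: complex) \<le> 1 / 2"
  proof (rule Lim_norm_ubound[OF _ lim])
    show "\<forall>\<^sub>F F in finite_subsets_at_top (A N - {1}). norm (sum f F) \<le> 1 / 2"
    proof (rule eventually_finite_subsets_at_top_weakI)
      fix F assume F: "finite F" "F \<subseteq> A N - {1}"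
      have big: "n > N" if "n \<in> F" for n
      proof (rule ccontr)
        assume "\<not> n > N"
        have n: "n \<in> A N" "n \<noteq> 1" using F that by auto
        then obtain p where p: "prime p" "p dvd n" using prime_factor_nat by blast
        hence "p \<le> n" using n by (auto simp: A_def dest: dvd_imp_le)
        thus False using p n \<open>\<not> n > N\<close> by (auto simp: A_def)
      qed
      define g where "g = (\<lambda>i. norm (f (Suc (i + N))))"
      have "summable g" unfolding g_def using summable_ignore_initial_segment[OF summ, of N] by simp
      have "norm (sum f F) \<le> (\<Sum>n\<in>F. norm (f n))" by (rule norm_sum)
      also have "\<dots> = (\<Sum>i\<in>(\<lambda>n. n - Suc N) ` F. g i)"
      proof (subst sum.reindex)
        show "inj_on (\<lambda>n. n - Suc N) F"
          using big by (intro inj_onI) (metis Suc_le_eq le_add_diff_inverse2)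
        have "g (n - Suc N) = norm (f n)" if "n \<in> F" for n
          using big[OF that] by (simp add: g_def)
        thus "(\<Sum>n\<in>F. norm (f n)) = sum (g \<circ> (\<lambda>n. n - Suc N)) F" by simp
      qed
      also have "\<dots> \<le> (\<Sum>i. g i)"
        using F \<open>summable g\<close> by (intro sum_le_suminf) (auto simp: g_def)
      also have "\<dots> \<le> 1 / 2"
        using N[of N] by (simp add: g_def)
      finally show "norm (sum f F) \<le> 1 / 2" .
    qed
  qed auto
  thus False by simp
qed

text \<open>On Re s = 2 the first term of the Dirichlet series outweighs the rest, since 1/(n+1)^2 <
  1/n - 1/(n+1). The telescoping sum is exactly 1, so the strictness of this inequality is what
  makes the constant positive.\<close>

lemma norm_zeta_reg_ge:
  obtains c where "c > 0" "\<And>t. norm (zeta_reg (2 + \<i> * of_real t)) \<ge> c"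
proof
  define a where "a = (\<lambda>n. real (Suc n) powr (- 2))"
  have a: "summable a" unfolding a_def by (rule summable_Suc_powr) simp
  have tel: "(\<lambda>n. 1 / real (Suc n) - 1 / real (Suc (Suc n))) sums 1"
    using telescope_sums'[of "\<lambda>n. 1 / real (Suc n)" 0] LIMSEQ_inverse_real_of_nat
    by (simp add: inverse_eq_divide)
  have less: "a (Suc n) < 1 / real (Suc n) - 1 / real (Suc (Suc n))" for n
  proof -
    define m where "m = real (Suc n)"
    have "m > 0" "real (Suc (Suc n)) = m + 1" by (simp_all add: m_def)
    moreover from this have "a (Suc n) = 1 / ((m + 1) * (m + 1))"
      by (simp add: a_def powr_minus divide_inverse power2_eq_square del: of_nat_Suc)
    moreover have "1 / m - 1 / (m + 1) = 1 / (m * (m + 1))"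
      using \<open>m > 0\<close> by (simp add: field_simps)
    moreover have "1 / ((m + 1) * (m + 1)) < 1 / (m * (m + 1))"
      using \<open>m > 0\<close> by (intro divide_strict_left_mono mult_strict_right_mono) auto
    ultimately show ?thesis by (simp add: m_def)
  qed
  have S: "(\<Sum>n. a (Suc n)) < 1"
  proof -
    have "summable (\<lambda>n. a (Suc n))" using a by (subst summable_Suc_iff)
    hence b: "(\<lambda>n. (1 / real (Suc n) - 1 / real (Suc (Suc n))) - a (Suc n)) sums (1 - (\<Sum>n. a (Suc n)))"
      by (intro sums_diff tel summable_sums)
    have "0 < (\<Sum>n. (1 / real (Suc n) - 1 / real (Suc (Suc n))) - a (Suc n))"
      using less by (intro suminf_pos sums_summable[OF b]) (simp only: diff_gt_0_iff_gt)
    also have "\<dots> = 1 - (\<Sum>n. a (Suc n))"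
      using b by (simp only: sums_iff)
    finally show ?thesis by simp
  qed
  thus "1 - (\<Sum>n. a (Suc n)) > 0" by simp
  fix t :: real
  define s where "s = 2 + \<i> * of_real t"
  have s: "Re s = 2" "s \<noteq> 1" by (auto simp: s_def complex_eq_iff)
  define f where "f = (\<lambda>n. 1 / of_nat (Suc n) powr s :: complex)"
  have norm_f: "norm (f n) = a n" for n
    unfolding f_def norm_divide a_def using s
    by (subst norm_powr_real_powr) (auto simp: powr_minus divide_inverse simp del: of_nat_Suc)
  have f: "f sums zeta s" unfolding f_def using s by (intro zeta_sums) auto
  hence "zeta s = f 0 + (\<Sum>n. f (Suc n))"
    using suminf_split_head[of f] by (simp add: sums_iff)
  moreover have "norm (\<Sum>n. f (Suc n)) \<le> (\<Sum>n. a (Suc n))"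
    using a by (intro norm_suminf_le) (auto simp: norm_f summable_Suc_iff)
  moreover have "f 0 = 1" by (simp add: f_def)
  ultimately have "norm (zeta s) \<ge> 1 - (\<Sum>n. a (Suc n))"
    using norm_triangle_ineq2[of "1" "- (\<Sum>n. f (Suc n))"] by simp
  moreover have "norm (s - 1) \<ge> 1"
    using abs_Re_le_cmod[of "s - 1"] s by simp
  moreover have "zeta_reg s = (s - 1) * zeta s"
    using s by (simp add: zeta_eq)
  ultimately show "norm (zeta_reg (2 + \<i> * of_real t)) \<ge> 1 - (\<Sum>n. a (Suc n))"
    using S mult_mono[of 1 "norm (s - 1)" "1 - (\<Sum>n. a (Suc n))" "norm (zeta s)"]
    by (simp add: norm_mult s_def)
qed

section \<open>Nontrivial zeros and their number\<close>

text \<open>The zeros are divided out one at a time. The nonzero value at \<open>w0\<close> and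
  connectedness rule out zeros of infinite order.\<close>

lemma holomorphic_factor_zeros:
  fixes f :: "complex \<Rightarrow> complex"
  assumes "f holomorphic_on A" "open A" "connected A" "w0 \<in> A" "f w0 \<noteq> 0"
    and "finite S" "S \<subseteq> A"
  shows "\<exists>g. g holomorphic_on A \<and> (\<forall>w\<in>A. f w = (\<Prod>a\<in>S. (w - a) ^ nat (zorder f a)) * g w)"
  using assms(6,7)
proof (induction S rule: finite_induct)
  case empty
  show ?case using assms(1) by auto
next
  case (insert a S)
  define P where "P = (\<lambda>w. \<Prod>a\<in>S. (w - a) ^ nat (zorder f a))"
  define n where "n = nat (zorder f a)"
  obtain g where g: "g holomorphic_on A" "\<And>w. w \<in> A \<Longrightarrow> f w = P w * g w"
    using insert by (auto simp: P_def)
  obtain r where r: "r > 0" "cball a r \<subseteq> A" "zor_poly f a holomorphic_on cball a r"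
      "\<And>w. w \<in> cball a r \<Longrightarrow> f w = zor_poly f a w * (w - a) ^ n"
    using zorder_exist_zero[of f A a] assms insert.prems unfolding n_def by blast
  have P0: "P w \<noteq> 0 \<longleftrightarrow> w \<notin> S \<or> (\<forall>a\<in>S. w = a \<longrightarrow> nat (zorder f a) = 0)" for w
    using insert.hyps by (auto simp: P_def)
  have "open (ball a r - S)"
    using insert.hyps by (intro open_Diff) (auto intro: finite_imp_closed)
  \<comment> \<open>Two holomorphic descriptions cover \<open>A\<close>: the quotient by
    \<open>(w - a) ^ n\<close> away from \<open>a\<close>, and \<open>zor_poly f a / P\<close> on a
    ball about \<open>a\<close> with the earlier points \<open>S\<close> removed. The value at
    \<open>a\<close> is taken from the second.\<close>
  define h where "h = (\<lambda>w. if w = a then zor_poly f a a / P a else g w / (w - a) ^ n)"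
  have "(\<lambda>w. g w / (w - a) ^ n) holomorphic_on A - {a}"
    using g by (intro holomorphic_intros) (auto intro: holomorphic_on_subset)
  hence 1: "h holomorphic_on A - {a}"
    by (rule holomorphic_transform) (auto simp: h_def)
  have "(\<lambda>w. zor_poly f a w / P w) holomorphic_on ball a r - S"
    using r(3) P0 unfolding P_def[abs_def]
    by (intro holomorphic_intros) (auto intro: holomorphic_on_subset simp: P_def)
  moreover have "zor_poly f a w / P w = h w" if w: "w \<in> ball a r - S" for w
  proof (cases "w = a")
    case False
    have "w \<in> cball a r" "w \<in> A" using w r(2) by auto
    hence "P w * g w = zor_poly f a w * (w - a) ^ n"
      using g(2)[of w] r(4)[of w] by simp
    moreover have "P w \<noteq> 0" using w P0 by blast
    ultimately show ?thesis using False by (simp add: h_def field_simps)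
  qed (simp add: h_def)
  ultimately have 2: "h holomorphic_on ball a r - S"
    by (rule holomorphic_transform)
  have "h holomorphic_on (A - {a}) \<union> (ball a r - S)"
    using 1 2 \<open>open A\<close> \<open>open (ball a r - S)\<close> by (intro holomorphic_on_Un) auto
  moreover have "(A - {a}) \<union> (ball a r - S) = A"
    using r insert.hyps(2) insert.prems by auto
  ultimately have "h holomorphic_on A" by simp
  moreover have "f w = (\<Prod>a\<in>insert a S. (w - a) ^ nat (zorder f a)) * h w" if "w \<in> A" for w
  proof (cases "w = a")
    case True
    have "P a \<noteq> 0" using P0 insert.hyps by blast
    moreover have "f a = zor_poly f a a * 0 ^ n" using r(1) r(4)[of a] by simp
    ultimately show ?thesis
      using insert.hyps True by (simp add: h_def n_def[symmetric]) (simp add: P_def)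
  next
    case False
    thus ?thesis
      using insert.hyps that g(2) by (simp add: h_def n_def[symmetric]) (simp add: P_def)
  qed
  ultimately show ?case by blast
qed

text \<open>Dividing by Blaschke factors rather than by plain linear factors makes the bound nontrivial for
  every \<open>r < R\<close>, not only for \<open>2 * r < R\<close>.\<close>
lemma jensen_zero_count:
  fixes f :: "complex \<Rightarrow> complex"
  assumes "f holomorphic_on A" "open A" "connected A" "cball c R \<subseteq> A" "f c \<noteq> 0"
    and "0 < r" "r < R" "\<And>w. w \<in> sphere c R \<Longrightarrow> norm (f w) \<le> M"
    and "finite S" "S \<subseteq> cball c r"
  shows "norm (f c) * (R / r) ^ (\<Sum>a\<in>S. nat (zorder f a)) \<le> M"
proof -
  define n where "n = (\<lambda>a. nat (zorder f a))"
  define N where "N = (\<Sum>a\<in>S. n a)"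
  have "R > 0" using assms by simp
  have "c \<in> A" using assms(4) \<open>R > 0\<close> by auto
  have "S \<subseteq> A" using assms(4,7,10) by (auto simp: subset_iff)
  obtain g where g: "g holomorphic_on A" "\<And>w. w \<in> A \<Longrightarrow> f w = (\<Prod>a\<in>S. (w - a) ^ n a) * g w"
    using holomorphic_factor_zeros[OF assms(1,2,3) \<open>c \<in> A\<close> assms(5,9) \<open>S \<subseteq> A\<close>] by (auto simp: n_def)
  \<comment> \<open>\<open>B a w\<close> has modulus \<open>norm (w - a)\<close> on the circle and R
    at the centre. Exchanging the linear factors for these leaves the modulus of f on the circle
    unchanged, while at the centre each factor of size at most r becomes R.\<close>
  define B where "B = (\<lambda>a w. (of_real (R\<^sup>2) - cnj (a - c) * (w - c)) / of_real R)"
  define G where "G = (\<lambda>w. (\<Prod>a\<in>S. B a w ^ n a) * g w)"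
  have "G holomorphic_on A"
    unfolding G_def B_def using \<open>R > 0\<close> g(1) by (intro holomorphic_intros) auto
  have Gc: "norm (G c) \<le> M"
  proof (rule maximum_modulus_frontier[of G "cball c R"])
    show "G holomorphic_on interior (cball c R)"
      using \<open>G holomorphic_on A\<close> assms(4) by (rule holomorphic_on_subset[OF _ order.trans[OF interior_subset]])
    show "continuous_on (closure (cball c R)) G"
      using \<open>G holomorphic_on A\<close> assms(4)
      by (auto intro!: holomorphic_on_imp_continuous_on intro: holomorphic_on_subset)
    show "c \<in> cball c R" using \<open>R > 0\<close> by simp
    fix w assume "w \<in> frontier (cball c R)"
    hence w: "w \<in> sphere c R" using \<open>R > 0\<close> by simp
    hence R: "norm (w - c) = R" by (simp add: dist_norm norm_minus_commute)
    have B: "norm (B a w) = norm (w - a)" for a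
    proof -
      have "of_real (R\<^sup>2) = (w - c) * cnj (w - c)"
        unfolding R[symmetric] by (rule complex_norm_square)
      hence "of_real (R\<^sup>2) - cnj (a - c) * (w - c) = (w - c) * cnj (w - a)"
        by (simp add: algebra_simps)
      hence "norm (B a w) = norm (w - c) * norm (cnj (w - a)) / R"
        using \<open>R > 0\<close> by (simp only: B_def norm_divide norm_mult) simp
      thus ?thesis using \<open>R > 0\<close> by (simp only: R complex_mod_cnj) simp
    qed
    have "norm (G w) = norm (f w)"
      using g(2)[of w] w assms(4) by (auto simp: G_def norm_mult prod_norm[symmetric] norm_power B)
    thus "norm (G w) \<le> M" using assms(8)[OF w] by simp
  qed auto
  have Gc': "norm (G c) = R ^ N * norm (g c)"
    using \<open>R > 0\<close>
    by (simp add: G_def B_def norm_mult norm_divide norm_power prod_norm[symmetric] power_sum N_def power2_eq_square)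
  have "norm (f c) \<le> r ^ N * norm (g c)"
  proof -
    have "norm (f c) = (\<Prod>a\<in>S. norm (c - a) ^ n a) * norm (g c)"
      using g(2)[OF \<open>c \<in> A\<close>] by (simp add: norm_mult prod_norm[symmetric] norm_power)
    also have "\<dots> \<le> (\<Prod>a\<in>S. r ^ n a) * norm (g c)"
      using assms(10) by (intro mult_right_mono prod_mono conjI power_mono) (auto simp: dist_norm)
    finally show ?thesis by (simp add: power_sum N_def)
  qed
  hence "norm (f c) * (R / r) ^ N \<le> (r ^ N * norm (g c)) * (R / r) ^ N"
    using assms(6) \<open>R > 0\<close> by (intro mult_right_mono) auto
  also have "\<dots> = R ^ N * norm (g c)"
    using assms(6) by (simp add: power_divide)
  also have "\<dots> \<le> M" using Gc Gc' by simp
  finally show ?thesis by (simp add: N_def n_def)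
qed

lemma zorder_nonneg_factor:
  fixes f :: "complex \<Rightarrow> complex"
  assumes "f holomorphic_on A" "open A" "connected A" "z \<in> A" "w0 \<in> A" "f w0 \<noteq> 0"
  obtains g r where "r > 0" "cball z r \<subseteq> A" "g holomorphic_on cball z r"
    "\<And>w. w \<in> cball z r \<Longrightarrow> f w = g w * (w - z) ^ nat (zorder f z)" "g z \<noteq> 0"
    "zorder f z \<ge> 0" "f z = 0 \<longleftrightarrow> zorder f z > 0"
proof -
  have *: "\<exists>w\<in>A. f w \<noteq> 0" using assms by blast
  obtain r where "r > 0" "cball z r \<subseteq> A" "zor_poly f z holomorphic_on cball z r"
    "\<forall>w\<in>cball z r. f w = zor_poly f z w * (w - z) ^ nat (zorder f z) \<and> zor_poly f z w \<noteq> 0"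
    using zorder_exist_zero[OF assms(1-4) *] by blast
  moreover have "if f z = 0 then zorder f z > 0 else zorder f z = 0"
    using zorder_exist_zero[OF assms(1-4) *] by blast
  ultimately show ?thesis
    by (intro that[of r "zor_poly f z"]) (auto split: if_splits)
qed

section \<open>Location and symmetry of the nontrivial zeros\<close>

lemma zeta_factor_eq_0_imp_even:
  assumes "Re s < 1" "zeta_factor s = 0"
  obtains n :: int where "s = 2 * of_int n"
proof -
  have "Gamma (1 - s) \<noteq> 0"
    using not_nonpos_Int_if_Re_pos[of "1 - s"] assms by (simp add: Gamma_eq_zero_iff)
  hence "sin (of_real pi * s / 2) = 0"
    using assms by (simp add: zeta_factor_def)
  then obtain n :: int where "of_real pi * s / 2 = of_real (of_int n * pi)"
    unfolding sin_eq_0 by auto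
  hence "s = 2 * of_int n" by (simp add: field_simps)
  thus ?thesis by (rule that)
qed

text \<open>The definition excludes just the negative even integers, so the strip has to be derived.
  For Re \<rho> < 0 the factor zeta(1 - \<rho>) is nonzero, hence a zero comes from the sine and
  lies at an even integer, necessarily negative.\<close>

lemma nontrivial_zeros_Re:
  assumes "\<rho> \<in> nontrivial_zeros"
  shows "0 \<le> Re \<rho>" "Re \<rho> \<le> 1" "\<rho> \<noteq> 0" "\<rho> \<noteq> 1" "zeta \<rho> = 0"
proof -
  have \<rho>: "\<rho> \<noteq> 1" "zeta \<rho> = 0" "\<And>k. k \<ge> 1 \<Longrightarrow> \<rho> \<noteq> - 2 * of_nat k"
    using assms by (auto simp: nontrivial_zeros_def)
  show "\<rho> \<noteq> 1" "zeta \<rho> = 0" by fact+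
  show "Re \<rho> \<le> 1" using zeta_nonzero_right \<rho> by force
  show "\<rho> \<noteq> 0" using zeta_0 \<rho> by auto
  show "0 \<le> Re \<rho>"
  proof (rule ccontr)
    assume neg: "\<not> 0 \<le> Re \<rho>"
    hence "zeta \<rho> = zeta_factor \<rho> * zeta (1 - \<rho>)"
      using \<open>\<rho> \<noteq> 0\<close> by (intro zeta_functional_equation) auto
    hence "zeta_factor \<rho> = 0"
      using \<rho>(2) zeta_nonzero_right[of "1 - \<rho>"] neg by simp
    then obtain n :: int where n: "\<rho> = 2 * of_int n"
      using zeta_factor_eq_0_imp_even[of \<rho>] neg by auto
    hence "n < 0" using neg by simp
    hence "\<rho> = - 2 * of_nat (nat (- n))" "nat (- n) \<ge> 1" using n by (simp_all add: of_nat_nat)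
    thus False using \<rho>(3) by blast
  qed
qed

text \<open>Multiplicities are moved to \<open>zeta_reg\<close> because the Jensen discs may contain
  the pole 1 of zeta. Dividing by the nonvanishing s - 1 does not affect the order.\<close>

lemma zorder_zeta_eq_zorder_zeta_reg:
  assumes "Re \<rho> > - 1" "\<rho> \<noteq> 1"
  shows "zorder zeta \<rho> = zorder zeta_reg \<rho>"
proof -
  define A where "A = {s. Re s > - 1}"
  have A: "zeta_reg holomorphic_on A" "open A" "connected A" "\<rho> \<in> A" "0 \<in> A" "zeta_reg 0 \<noteq> 0"
    using assms by (auto simp: A_def holomorphic_zeta_reg open_halfspace_Re_gt zeta_reg_0
        intro!: convex_connected convex_halfspace_Re_gt)
  obtain g r where g: "r > 0" "cball \<rho> r \<subseteq> A" "g holomorphic_on cball \<rho> r"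
    "\<And>w. w \<in> cball \<rho> r \<Longrightarrow> zeta_reg w = g w * (w - \<rho>) ^ nat (zorder zeta_reg \<rho>)" "g \<rho> \<noteq> 0"
    "zorder zeta_reg \<rho> \<ge> 0"
    using zorder_nonneg_factor[OF A] by metis
  show ?thesis
  proof (rule zorder_eqI[where g = "\<lambda>w. g w / (w - 1)" and S = "ball \<rho> r - {1}"])
    show "(\<lambda>w. g w / (w - 1)) holomorphic_on ball \<rho> r - {1}"
      by (intro holomorphic_intros holomorphic_on_subset[OF g(3)]) auto
    fix w assume w: "w \<in> ball \<rho> r - {1}" "w \<noteq> \<rho>"
    hence "w \<in> A" "w \<in> cball \<rho> r" using g(2) by auto
    thus "zeta w = g w / (w - 1) * (w - \<rho>) powi zorder zeta_reg \<rho>"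
      using zeta_eq[of w] w g(4,6) by (simp add: A_def power_int_def)
  qed (use g assms in auto)
qed

text \<open>The functional equation multiplies the local factorization at 1 - s by
  \<open>zeta_factor\<close>, which is nonzero at s; the sign (-1)^n from the reflection joins the
  nonvanishing factor.\<close>

lemma zorder_zeta_reflect:
  assumes "\<bar>Re s\<bar> < 1" "s \<noteq> 0"
  shows "zorder zeta s = zorder zeta (1 - s)"
proof -
  have nz: "1 - s \<in> - {1}" "0 \<in> - {1 :: complex}" "zeta 0 \<noteq> 0"
    using assms by (auto simp: zeta_0)
  have "connected (- {1 :: complex})" by (rule connected_punctured_universe) simp
  then obtain g r where g: "r > 0" "cball (1 - s) r \<subseteq> - {1}" "g holomorphic_on cball (1 - s) r"
    "\<And>w. w \<in> cball (1 - s) r \<Longrightarrow> zeta w = g w * (w - (1 - s)) ^ nat (zorder zeta (1 - s))" "g (1 - s) \<noteq> 0"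
    "zorder zeta (1 - s) \<ge> 0"
    using zorder_nonneg_factor[OF holomorphic_zeta _ _ nz] by (metis open_Compl closed_singleton)
  define n where "n = nat (zorder zeta (1 - s))"
  define U where "U = ball s r \<inter> {w. Re w < 1} - {0}"
  have refl: "1 - w \<in> cball (1 - s) r" if "w \<in> U" for w
    using that by (auto simp: U_def dist_norm norm_minus_commute)
  show ?thesis
  proof (rule zorder_eqI[where g = "\<lambda>w. zeta_factor w * ((- 1) ^ n * g (1 - w))" and S = U])
    show "open U" unfolding U_def by (intro open_Diff open_Int open_halfspace_Re_lt) auto
    show "s \<in> U" using assms g(1) by (auto simp: U_def)
    have "(g \<circ> (\<lambda>w. 1 - w)) holomorphic_on U"
      using refl by (intro holomorphic_on_compose_gen[OF _ g(3)] holomorphic_intros) auto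
    moreover have "zeta_factor holomorphic_on U"
      by (rule holomorphic_on_subset[OF holomorphic_zeta_factor]) (auto simp: U_def)
    ultimately show "(\<lambda>w. zeta_factor w * ((- 1) ^ n * g (1 - w))) holomorphic_on U"
      unfolding o_def by (intro holomorphic_intros)
    show "zeta_factor s * ((- 1) ^ n * g (1 - s)) \<noteq> 0"
      using zeta_factor_nonzero[OF assms] g(5) by simp
    fix w assume w: "w \<in> U" "w \<noteq> s"
    have "zeta w = zeta_factor w * zeta (1 - w)"
      using w by (intro zeta_functional_equation) (auto simp: U_def)
    also have "zeta (1 - w) = g (1 - w) * (- 1 * (w - s)) ^ n"
      using g(4)[OF refl[OF w(1)]] by (simp add: n_def)
    finally show "zeta w = zeta_factor w * ((- 1) ^ n * g (1 - w)) * (w - s) powi zorder zeta (1 - s)"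
      using g(6) by (simp only: power_mult_distrib) (simp add: power_int_def n_def)
  qed
qed

lemma nontrivial_zeros_reflect:
  assumes "\<rho> \<in> nontrivial_zeros"
  shows "1 - \<rho> \<in> nontrivial_zeros" "zorder zeta (1 - \<rho>) = zorder zeta \<rho>"
proof -
  note \<rho> = nontrivial_zeros_Re[OF assms]
  have "zeta (1 - \<rho>) = 0 \<and> zorder zeta (1 - \<rho>) = zorder zeta \<rho>"
  proof (cases "Re \<rho> < 1")
    case True
    have "zeta \<rho> = zeta_factor \<rho> * zeta (1 - \<rho>)" using True \<rho> by (intro zeta_functional_equation) auto
    moreover have "zeta_factor \<rho> \<noteq> 0" using True \<rho> by (intro zeta_factor_nonzero) auto
    moreover have "zorder zeta \<rho> = zorder zeta (1 - \<rho>)"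
      using True \<rho> by (intro zorder_zeta_reflect) auto
    ultimately show ?thesis using \<rho> by auto
  next
    case False
    hence Re: "Re (1 - \<rho>) = 0" "1 - \<rho> \<noteq> 0" using \<rho> by auto
    hence "zeta (1 - \<rho>) = zeta_factor (1 - \<rho>) * zeta (1 - (1 - \<rho>))"
      by (intro zeta_functional_equation) auto
    moreover have "zorder zeta (1 - \<rho>) = zorder zeta (1 - (1 - \<rho>))"
      using Re by (intro zorder_zeta_reflect) auto
    ultimately show ?thesis using \<rho> by simp
  qed
  thus "1 - \<rho> \<in> nontrivial_zeros" "zorder zeta (1 - \<rho>) = zorder zeta \<rho>"
    using \<rho> by (auto simp: nontrivial_zeros_def complex_eq_iff)
qed

lemma zorder_zeta_pos:
  assumes "\<rho> \<in> nontrivial_zeros"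
  shows "zorder zeta \<rho> > 0"
proof -
  have nz: "\<rho> \<in> - {1}" "0 \<in> - {1 :: complex}" "zeta 0 \<noteq> 0"
    using nontrivial_zeros_Re[OF assms] by (auto simp: zeta_0)
  have "connected (- {1 :: complex})" by (rule connected_punctured_universe) simp
  thus ?thesis
    using zorder_nonneg_factor[OF holomorphic_zeta _ _ nz] nontrivial_zeros_Re(5)[OF assms]
    by (metis open_Compl closed_singleton)
qed

section \<open>Counting the nontrivial zeros near a given height\<close>

lemma ln_le_2_sqrt: "x > 0 \<Longrightarrow> ln x \<le> 2 * sqrt (x :: real)"
  using ln_le_minus_one[of "sqrt x"] ln_sqrt[of x] real_sqrt_gt_zero[of x] by simp

text \<open>Jensen's bound about 2 + it. Since Re \<rho> \<le> 1, the zeros differ from the centre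
  by at most 3/2 horizontally and 1/2 vertically, so their distance is at most sqrt(10)/2 < 8/5.
  Radius 5/2 reaches exactly to Re s = -1/2. The ratio of these radii is 25/16.\<close>

lemma zero_count_right_half:
  obtains C where "C > 0"
    "\<And>t S. finite S \<Longrightarrow> S \<subseteq> nontrivial_zeros \<Longrightarrow> (\<And>\<rho>. \<rho> \<in> S \<Longrightarrow> Re \<rho> \<ge> 1 / 2 \<and> \<bar>Im \<rho> - t\<bar> \<le> 1 / 2) \<Longrightarrow>
       (\<Sum>\<rho>\<in>S. real_of_int (zorder zeta \<rho>)) \<le> C * sqrt (6 + \<bar>t\<bar>)"
proof -
  obtain c where c: "c > 0" "\<And>t. norm (zeta_reg (2 + \<i> * of_real t)) \<ge> c"
    using norm_zeta_reg_ge by blast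
  obtain M where M: "M > 0" "\<And>s. Re s \<ge> - 1 / 2 \<Longrightarrow> norm (zeta_reg s) \<le> M * (1 + norm s) ^ 3"
    using norm_zeta_reg_le by blast
  define q where "q = ln (25 / 16 :: real)"
  have "q > 0" by (simp add: q_def)
  define C where "C = (\<bar>ln (M / c)\<bar> + 6) / q"
  show thesis
  proof (rule that[of C])
    show "C > 0" using \<open>q > 0\<close> by (simp add: C_def add_nonneg_pos)
    fix t :: real and S
    assume S: "finite S" "S \<subseteq> nontrivial_zeros" and near: "\<And>\<rho>. \<rho> \<in> S \<Longrightarrow> Re \<rho> \<ge> 1 / 2 \<and> \<bar>Im \<rho> - t\<bar> \<le> 1 / 2"
    define s where "s = 2 + \<i> * of_real t"
    define N where "N = (\<Sum>\<rho>\<in>S. nat (zorder zeta_reg \<rho>))"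
    \<comment> \<open>Dominates \<open>1 + norm w\<close> on the circle, which is at most 1 + (2 +
      |t|) + 5/2.\<close>
    define L where "L = 6 + \<bar>t\<bar>"
    have "L \<ge> 1" by (simp add: L_def)
    have Re: "Re w \<ge> - 1 / 2" if "w \<in> cball s (5 / 2)" for w
      using that complex_Re_le_cmod[of "s - w"] by (simp add: dist_norm s_def)
    have sub: "S \<subseteq> cball s (8 / 5)"
    proof
      fix \<rho> assume \<rho>: "\<rho> \<in> S"
      have "Re \<rho> \<le> 1" using \<rho> S nontrivial_zeros_Re by blast
      hence "\<bar>2 - Re \<rho>\<bar> \<le> 3 / 2" "\<bar>t - Im \<rho>\<bar> \<le> 1 / 2"
        using near[OF \<rho>] by (auto simp: abs_minus_commute[of t])
      hence "(2 - Re \<rho>)\<^sup>2 + (t - Im \<rho>)\<^sup>2 \<le> (3 / 2)\<^sup>2 + (1 / 2)\<^sup>2"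
        by (intro add_mono) (metis abs_ge_zero power2_abs power_mono)+
      also have "\<dots> \<le> (8 / 5)\<^sup>2" by (simp add: power2_eq_square)
      finally have "norm (s - \<rho>) \<le> 8 / 5"
        unfolding cmod_def by (intro real_le_lsqrt) (auto simp: s_def)
      thus "\<rho> \<in> cball s (8 / 5)" by (simp add: dist_norm)
    qed
    have "norm (zeta_reg s) * ((5 / 2) / (8 / 5)) ^ N \<le> M * L ^ 3"
      unfolding N_def
    proof (rule jensen_zero_count[where A = "{s. Re s > - 1}"])
      show "connected {s. - 1 < Re s}" by (intro convex_connected convex_halfspace_Re_gt)
      show "cball s (5 / 2) \<subseteq> {s. - 1 < Re s}" using Re by force
      show "zeta_reg s \<noteq> 0" using c(2)[of t] c(1) by (auto simp: s_def)
      fix w assume w: "w \<in> sphere s (5 / 2)"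
      have "norm w \<le> norm s + 5 / 2"
        using w norm_triangle_ineq2[of w s] by (simp add: dist_norm norm_minus_commute)
      moreover have "norm s \<le> 2 + \<bar>t\<bar>"
        using norm_triangle_ineq[of 2 "\<i> * of_real t"] by (simp add: s_def norm_mult)
      ultimately have "1 + norm w \<le> L" by (simp add: L_def)
      hence "M * (1 + norm w) ^ 3 \<le> M * L ^ 3"
        using M(1) by (intro mult_left_mono power_mono) auto
      moreover have "w \<in> cball s (5 / 2)" using w by simp
      ultimately show "norm (zeta_reg w) \<le> M * L ^ 3"
        using M(2)[OF Re] by (meson order.trans)
    qed (use S sub in \<open>auto simp: holomorphic_zeta_reg open_halfspace_Re_gt\<close>)
    moreover have "c * (25 / 16) ^ N \<le> norm (zeta_reg s) * ((5 / 2) / (8 / 5)) ^ N"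
      using c(2)[of t] by (intro mult_mono) (auto simp: s_def)
    ultimately have "c * (25 / 16) ^ N \<le> M * L ^ 3" by linarith
    hence "(25 / 16) ^ N \<le> M / c * L ^ 3" using c(1) by (simp add: field_simps)
    hence "ln ((25 / 16) ^ N) \<le> ln (M / c * L ^ 3)"
      by (intro ln_mono) auto
    also have "ln (M / c * L ^ 3) = ln (M / c) + 3 * ln L"
      using M(1) c(1) \<open>L \<ge> 1\<close> by (subst ln_mult) (auto simp: ln_realpow)
    finally have "real N * q \<le> ln (M / c) + 3 * ln L"
      by (simp add: ln_realpow q_def)
    \<comment> \<open>The logarithmic count is weakened to a square root here;
      \<open>L \<ge> 1\<close> absorbs the constant as well.\<close>
    also have "\<dots> \<le> \<bar>ln (M / c)\<bar> * sqrt L + 3 * (2 * sqrt L)"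
    proof (intro add_mono mult_left_mono ln_le_2_sqrt)
      have "\<bar>ln (M / c)\<bar> * 1 \<le> \<bar>ln (M / c)\<bar> * sqrt L"
        using \<open>L \<ge> 1\<close> by (intro mult_left_mono) auto
      thus "ln (M / c) \<le> \<bar>ln (M / c)\<bar> * sqrt L" by linarith
    qed (use \<open>L \<ge> 1\<close> in auto)
    also have "\<dots> = (\<bar>ln (M / c)\<bar> + 6) * sqrt L" by (simp add: distrib_right)
    also have "\<bar>ln (M / c)\<bar> + 6 = C * q" using \<open>q > 0\<close> by (simp add: C_def)
    also have "C * q * sqrt L = C * sqrt L * q" by simp
    finally have "real N \<le> C * sqrt L" using \<open>q > 0\<close> by simp
    moreover have "real N = (\<Sum>\<rho>\<in>S. real_of_int (zorder zeta \<rho>))"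
      unfolding N_def of_nat_sum
    proof (intro sum.cong refl)
      fix \<rho> assume "\<rho> \<in> S"
      hence \<rho>: "\<rho> \<in> nontrivial_zeros" using S by blast
      have "zorder zeta_reg \<rho> = zorder zeta \<rho>"
        using nontrivial_zeros_Re[OF \<rho>] by (subst zorder_zeta_eq_zorder_zeta_reg) auto
      thus "real (nat (zorder zeta_reg \<rho>)) = real_of_int (zorder zeta \<rho>)"
        using zorder_zeta_pos[OF \<rho>] by simp
    qed
    ultimately show "(\<Sum>\<rho>\<in>S. real_of_int (zorder zeta \<rho>)) \<le> C * sqrt (6 + \<bar>t\<bar>)"
      by (simp add: L_def)
  qed
qed

text \<open>Zeros with real part below 1/2 are reflected by \<rho> \<mapsto> 1 - \<rho>, which keeps
  multiplicities and moves the window from height t to height -t, where the bound is the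
  same.\<close>

lemma zero_count:
  obtains C where "C > 0"
    "\<And>t S. finite S \<Longrightarrow> S \<subseteq> nontrivial_zeros \<Longrightarrow> (\<And>\<rho>. \<rho> \<in> S \<Longrightarrow> \<bar>Im \<rho> - t\<bar> \<le> 1 / 2) \<Longrightarrow>
       (\<Sum>\<rho>\<in>S. real_of_int (zorder zeta \<rho>)) \<le> C * sqrt (6 + \<bar>t\<bar>)"
proof -
  obtain C where C: "C > 0"
    "\<And>t S. finite S \<Longrightarrow> S \<subseteq> nontrivial_zeros \<Longrightarrow> (\<And>\<rho>. \<rho> \<in> S \<Longrightarrow> Re \<rho> \<ge> 1 / 2 \<and> \<bar>Im \<rho> - t\<bar> \<le> 1 / 2) \<Longrightarrow>
       (\<Sum>\<rho>\<in>S. real_of_int (zorder zeta \<rho>)) \<le> C * sqrt (6 + \<bar>t\<bar>)"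
    using zero_count_right_half by blast
  show thesis
  proof (rule that[of "2 * C"])
    show "2 * C > 0" using C by simp
    fix t :: real and S
    assume S: "finite S" "S \<subseteq> nontrivial_zeros" and near: "\<And>\<rho>. \<rho> \<in> S \<Longrightarrow> \<bar>Im \<rho> - t\<bar> \<le> 1 / 2"
    define S1 where "S1 = {\<rho>\<in>S. Re \<rho> \<ge> 1 / 2}"
    define S2 where "S2 = {\<rho>\<in>S. Re \<rho> < 1 / 2}"
    have "(\<Sum>\<rho>\<in>S1. real_of_int (zorder zeta \<rho>)) \<le> C * sqrt (6 + \<bar>t\<bar>)"
      using S near by (intro C(2)) (auto simp: S1_def)
    moreover have "(\<Sum>\<rho>\<in>(\<lambda>\<rho>. 1 - \<rho>) ` S2. real_of_int (zorder zeta \<rho>)) \<le> C * sqrt (6 + \<bar>- t\<bar>)"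
    proof (rule C(2))
      show "(\<lambda>\<rho>. 1 - \<rho>) ` S2 \<subseteq> nontrivial_zeros"
        using S nontrivial_zeros_reflect(1) by (auto simp: S2_def)
      fix \<rho> assume "\<rho> \<in> (\<lambda>\<rho>. 1 - \<rho>) ` S2"
      then obtain \<rho>' where "\<rho> = 1 - \<rho>'" "\<rho>' \<in> S" "Re \<rho>' < 1 / 2" by (auto simp: S2_def)
      thus "1 / 2 \<le> Re \<rho> \<and> \<bar>Im \<rho> - - t\<bar> \<le> 1 / 2" using near[of \<rho>'] by (auto simp: abs_minus_commute[of t])
    qed (use S in \<open>auto simp: S2_def\<close>)
    moreover have "(\<Sum>\<rho>\<in>(\<lambda>\<rho>. 1 - \<rho>) ` S2. real_of_int (zorder zeta \<rho>)) = (\<Sum>\<rho>\<in>S2. real_of_int (zorder zeta \<rho>))"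
      using S by (subst sum.reindex) (auto simp: inj_on_def S2_def nontrivial_zeros_reflect(2) intro!: sum.cong)
    moreover have "(\<Sum>\<rho>\<in>S. real_of_int (zorder zeta \<rho>)) =
        (\<Sum>\<rho>\<in>S1. real_of_int (zorder zeta \<rho>)) + (\<Sum>\<rho>\<in>S2. real_of_int (zorder zeta \<rho>))"
    proof -
      have "S = S1 \<union> S2" "S1 \<inter> S2 = {}" by (auto simp: S1_def S2_def)
      moreover have "finite S1" "finite S2" using S by (auto simp: S1_def S2_def)
      ultimately show ?thesis by (simp add: sum.union_disjoint)
    qed
    ultimately show "(\<Sum>\<rho>\<in>S. real_of_int (zorder zeta \<rho>)) \<le> 2 * C * sqrt (6 + \<bar>t\<bar>)"
      by simp
  qed
qed

lemma abs_Im_minus_round: "\<bar>y - of_int (round y)\<bar> \<le> (1 / 2 :: real)"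
  using of_int_round_abs_le[of y] by (simp add: abs_minus_commute)

text \<open>Multiplicities are at least 1, so the weighted count bounds the number of zeros in each
  unit window about an integer height. Finitely many windows cover the strip.\<close>

lemma finite_nontrivial_zeros_strip: "finite {\<rho> \<in> nontrivial_zeros. \<bar>Im \<rho>\<bar> < T}"
proof -
  obtain C where C: "C > 0"
    "\<And>t S. finite S \<Longrightarrow> S \<subseteq> nontrivial_zeros \<Longrightarrow> (\<And>\<rho>. \<rho> \<in> S \<Longrightarrow> \<bar>Im \<rho> - t\<bar> \<le> 1 / 2) \<Longrightarrow>
       (\<Sum>\<rho>\<in>S. real_of_int (zorder zeta \<rho>)) \<le> C * sqrt (6 + \<bar>t\<bar>)"
    using zero_count by blast
  define W where "W = (\<lambda>k::int. {\<rho> \<in> nontrivial_zeros. \<bar>Im \<rho> - of_int k\<bar> \<le> 1 / 2})"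
  have "finite (W k)" for k
  proof -
    have "card S \<le> nat \<lceil>C * sqrt (6 + \<bar>of_int k\<bar>)\<rceil>" if S: "S \<subseteq> W k" "finite S" for S
    proof -
      have "real (card S) = (\<Sum>\<rho>\<in>S. 1)" by simp
      also have "\<dots> \<le> (\<Sum>\<rho>\<in>S. real_of_int (zorder zeta \<rho>))"
        using S zorder_zeta_pos by (intro sum_mono) (force simp: W_def)
      also have "\<dots> \<le> C * sqrt (6 + \<bar>of_int k\<bar>)"
        using S by (intro C(2)) (auto simp: W_def)
      finally show ?thesis by linarith
    qed
    thus ?thesis using finite_if_finite_subsets_card_bdd by blast
  qed
  moreover have "{\<rho> \<in> nontrivial_zeros. \<bar>Im \<rho>\<bar> < T} \<subseteq> (\<Union>k\<in>{- \<lceil>T\<rceil> - 1..\<lceil>T\<rceil> + 1}. W k)"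
  proof
    fix \<rho> assume \<rho>: "\<rho> \<in> {\<rho> \<in> nontrivial_zeros. \<bar>Im \<rho>\<bar> < T}"
    have *: "\<bar>Im \<rho> - of_int (round (Im \<rho>))\<bar> \<le> 1 / 2" by (rule abs_Im_minus_round)
    hence "\<bar>Im \<rho> - of_int (round (Im \<rho>))\<bar> \<le> 1" by simp
    moreover have "\<bar>Im \<rho>\<bar> < T" "T \<le> of_int \<lceil>T\<rceil>" using \<rho> by auto
    ultimately have "real_of_int (round (Im \<rho>)) \<le> of_int (\<lceil>T\<rceil> + 1)"
        "of_int (- \<lceil>T\<rceil> - 1) \<le> real_of_int (round (Im \<rho>))"
      unfolding of_int_add of_int_diff of_int_minus of_int_1 by linarith+
    hence "round (Im \<rho>) \<in> {- \<lceil>T\<rceil> - 1..\<lceil>T\<rceil> + 1}"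
      by (simp only: of_int_le_iff atLeastAtMost_iff)
    with * show "\<rho> \<in> (\<Union>k\<in>{- \<lceil>T\<rceil> - 1..\<lceil>T\<rceil> + 1}. W k)" using \<rho> by (auto simp: W_def)
  qed
  ultimately show ?thesis by (meson finite_UN finite_atLeastAtMost_int finite_subset)
qed

section \<open>Convergence of sums over the zeros\<close>

lemma sum_int_le_suminf:
  fixes h :: "nat \<Rightarrow> real"
  assumes "summable h" "\<And>n. h n \<ge> 0" "finite I"
  shows "(\<Sum>k\<in>I. h (nat \<bar>k\<bar>)) \<le> 2 * suminf h"
proof -
  have *: "(\<Sum>k\<in>J. h (nat \<bar>k\<bar>)) \<le> suminf h" if "finite J" "inj_on (\<lambda>k. nat \<bar>k\<bar>) J" for J
  proof -
    have "(\<Sum>k\<in>J. h (nat \<bar>k\<bar>)) = sum h ((\<lambda>k. nat \<bar>k\<bar>) ` J)" using that by (simp add: sum.reindex)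
    also have "\<dots> \<le> suminf h" using assms that by (intro sum_le_suminf) auto
    finally show ?thesis .
  qed
  have "(\<Sum>k\<in>I. h (nat \<bar>k\<bar>)) = (\<Sum>k\<in>{k\<in>I. k \<ge> 0} \<union> {k\<in>I. k < 0}. h (nat \<bar>k\<bar>))"
    by (intro sum.cong) auto
  also have "\<dots> = (\<Sum>k\<in>{k\<in>I. k \<ge> 0}. h (nat \<bar>k\<bar>)) + (\<Sum>k\<in>{k\<in>I. k < 0}. h (nat \<bar>k\<bar>))"
    using assms by (intro sum.union_disjoint) auto
  also have "\<dots> \<le> suminf h + suminf h"
    using assms by (intro add_mono *) (auto simp: inj_on_def)
  finally show ?thesis by simp
qed

text \<open>The zeros are grouped by the integer j nearest to the imaginary part. A group has weight
  of order sqrt |j| and its terms are of order 1/(1 + j^2), so the groups are dominated by a series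
  of exponent -3/2. The factor 2 in \<open>h\<close> pays for replacing Im \<rho> by j.\<close>

lemma summable_zorder_over_square:
  "(\<lambda>\<rho>. real_of_int (zorder zeta \<rho>) / (1 + (Im \<rho>)\<^sup>2)) summable_on nontrivial_zeros"
proof -
  obtain C where C: "C > 0"
    "\<And>t S. finite S \<Longrightarrow> S \<subseteq> nontrivial_zeros \<Longrightarrow> (\<And>\<rho>. \<rho> \<in> S \<Longrightarrow> \<bar>Im \<rho> - t\<bar> \<le> 1 / 2) \<Longrightarrow>
       (\<Sum>\<rho>\<in>S. real_of_int (zorder zeta \<rho>)) \<le> C * sqrt (6 + \<bar>t\<bar>)"
    using zero_count by blast
  define h where "h = (\<lambda>n. 2 * C * (sqrt (6 + real n) / (1 + (real n)\<^sup>2)))"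
  have h_nonneg: "h n \<ge> 0" for n
    unfolding h_def using C(1) by (intro mult_nonneg_nonneg divide_nonneg_nonneg add_nonneg_nonneg) auto
  have "summable h"
    unfolding h_def
  proof (rule summable_mult, rule summable_comparison_test)
    show "summable (\<lambda>n. 6 * real (Suc n) powr (- 3 / 2))"
      by (intro summable_mult summable_Suc_powr) simp
    have "norm (sqrt (6 + real n) / (1 + (real n)\<^sup>2)) \<le> 6 * real (Suc n) powr (- 3 / 2)" for n
    proof -
      define x where "x = real (Suc n)"
      have "x \<ge> 1" by (simp add: x_def)
      have "sqrt (6 + real n) \<le> sqrt (9 * x)" by (simp add: x_def)
      hence 1: "sqrt (6 + real n) \<le> 3 * sqrt x" by (simp add: real_sqrt_mult)
      \<comment> \<open>Expanded, this says that (n + 1)^2 is at most 2 (1 + n^2).\<close>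
      have "0 \<le> (real n - 1)\<^sup>2" by simp
      hence 2: "x\<^sup>2 / 2 \<le> 1 + (real n)\<^sup>2"
        by (simp add: x_def power2_eq_square algebra_simps)
      have "sqrt (6 + real n) / (1 + (real n)\<^sup>2) \<le> (3 * sqrt x) / (x\<^sup>2 / 2)"
        using 1 2 \<open>x \<ge> 1\<close> by (intro frac_le) auto
      also have "\<dots> = 6 * (x powr (1 / 2) / x powr 2)"
        using \<open>x \<ge> 1\<close> by (simp add: powr_half_sqrt)
      also have "x powr (1 / 2) / x powr 2 = x powr (- 3 / 2)"
        by (subst powr_diff[symmetric]) simp
      finally show ?thesis by (simp add: x_def add_nonneg_nonneg)
    qed
    thus "\<exists>N. \<forall>n\<ge>N. norm (sqrt (6 + real n) / (1 + (real n)\<^sup>2)) \<le> 6 * real (Suc n) powr (- 3 / 2)"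
      by blast
  qed
  show ?thesis
  proof (rule nonneg_bdd_above_summable_on)
    show "bdd_above (sum (\<lambda>\<rho>. real_of_int (zorder zeta \<rho>) / (1 + (Im \<rho>)\<^sup>2)) ` {F. F \<subseteq> nontrivial_zeros \<and> finite F})"
    proof (rule bdd_aboveI2)
      fix F assume "F \<in> {F. F \<subseteq> nontrivial_zeros \<and> finite F}"
      hence F: "F \<subseteq> nontrivial_zeros" "finite F" by auto
      define k where "k = (\<lambda>\<rho>. round (Im \<rho>))"
      have "(\<Sum>\<rho>\<in>F. real_of_int (zorder zeta \<rho>) / (1 + (Im \<rho>)\<^sup>2)) =
            (\<Sum>j\<in>k ` F. \<Sum>\<rho>\<in>{\<rho>\<in>F. k \<rho> = j}. real_of_int (zorder zeta \<rho>) / (1 + (Im \<rho>)\<^sup>2))"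
        by (rule sum.image_gen[OF F(2)])
      also have "\<dots> \<le> (\<Sum>j\<in>k ` F. h (nat \<bar>j\<bar>))"
      proof (rule sum_mono)
        fix j
        have near: "\<bar>Im \<rho> - of_int j\<bar> \<le> 1 / 2" if "k \<rho> = j" for \<rho>
          using abs_Im_minus_round[of "Im \<rho>"] that by (auto simp: k_def)
        have "(\<Sum>\<rho>\<in>{\<rho>\<in>F. k \<rho> = j}. real_of_int (zorder zeta \<rho>) / (1 + (Im \<rho>)\<^sup>2)) \<le>
              (\<Sum>\<rho>\<in>{\<rho>\<in>F. k \<rho> = j}. real_of_int (zorder zeta \<rho>) * (2 / (1 + (of_int j)\<^sup>2)))"
        proof (rule sum_mono)
          fix \<rho> assume \<rho>: "\<rho> \<in> {\<rho>\<in>F. k \<rho> = j}"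
          define d where "d = Im \<rho> - of_int j"
          have "d\<^sup>2 \<le> (1 / 2)\<^sup>2" using near[of \<rho>] \<rho> unfolding d_def by (subst abs_le_square_iff[symmetric]) auto
          moreover have "(of_int j)\<^sup>2 = (Im \<rho>)\<^sup>2 - 2 * Im \<rho> * d + d\<^sup>2"
            by (simp add: d_def power2_eq_square algebra_simps)
          \<comment> \<open>Equivalent to j^2 \<le> 2 (Im \<rho>)^2 + 2 d^2, where the last summand
            is at most 1/2.\<close>
          moreover have "0 \<le> (Im \<rho> + d)\<^sup>2" by simp
          ultimately have "1 + (of_int j)\<^sup>2 \<le> 2 * (1 + (Im \<rho>)\<^sup>2)"
            by (simp add: power2_eq_square algebra_simps)
          moreover have "1 + (of_int j :: real)\<^sup>2 > 0" "1 + (Im \<rho>)\<^sup>2 > 0" by (simp_all add: add_pos_nonneg)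
          ultimately have "1 / (1 + (Im \<rho>)\<^sup>2) \<le> 2 / (1 + (of_int j)\<^sup>2)"
            by (simp add: field_simps)
          moreover have "zorder zeta \<rho> > 0" using \<rho> F by (intro zorder_zeta_pos) auto
          ultimately have "real_of_int (zorder zeta \<rho>) * (1 / (1 + (Im \<rho>)\<^sup>2)) \<le>
               real_of_int (zorder zeta \<rho>) * (2 / (1 + (of_int j)\<^sup>2))"
            by (intro mult_left_mono) auto
          thus "real_of_int (zorder zeta \<rho>) / (1 + (Im \<rho>)\<^sup>2) \<le>
               real_of_int (zorder zeta \<rho>) * (2 / (1 + (of_int j)\<^sup>2))" by simp
        qed
        also have "\<dots> = (\<Sum>\<rho>\<in>{\<rho>\<in>F. k \<rho> = j}. real_of_int (zorder zeta \<rho>)) * (2 / (1 + (of_int j)\<^sup>2))"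
          by (rule sum_distrib_right[symmetric])
        also have "\<dots> \<le> (C * sqrt (6 + \<bar>of_int j\<bar>)) * (2 / (1 + (of_int j)\<^sup>2))"
          using F near by (intro mult_right_mono C(2)) (auto simp: add_nonneg_nonneg)
        also have "\<dots> = h (nat \<bar>j\<bar>)" by (simp add: h_def)
        finally show "(\<Sum>\<rho>\<in>{\<rho>\<in>F. k \<rho> = j}. real_of_int (zorder zeta \<rho>) / (1 + (Im \<rho>)\<^sup>2)) \<le> h (nat \<bar>j\<bar>)" .
      qed
      also have "\<dots> \<le> 2 * suminf h"
        using F h_nonneg \<open>summable h\<close> by (intro sum_int_le_suminf) auto
      finally show "(\<Sum>\<rho>\<in>F. real_of_int (zorder zeta \<rho>) / (1 + (Im \<rho>)\<^sup>2)) \<le> 2 * suminf h" .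
    qed
    show "real_of_int (zorder zeta \<rho>) / (1 + (Im \<rho>)\<^sup>2) \<ge> 0" if "\<rho> \<in> nontrivial_zeros" for \<rho>
      using zorder_zeta_pos[OF that] by (intro divide_nonneg_nonneg) auto
  qed
qed

text \<open>With t = 1 - 1/z, the geometric sum extracts the factor 1 - t = 1/z from 1 - t^n, and
  |t| \<le> 2 bounds what remains. Used at both \<rho> and 1 - \<rho> with a = |Im \<rho>|, this
  supplies the two factors of decay.\<close>

lemma norm_one_minus_power_le:
  fixes z :: complex
  assumes "norm z \<ge> a" "a \<ge> 1"
  shows "norm (1 - (1 - 1 / z) ^ n) \<le> real n * 2 ^ n / a"
proof -
  define t where "t = 1 - 1 / z"
  have z: "norm (1 / z) \<le> 1 / a" using assms by (simp add: norm_divide frac_le)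
  also have "1 / a \<le> 1" using assms by simp
  finally have "norm t \<le> 2" using norm_triangle_ineq4[of 1 "1 / z"] by (simp add: t_def)
  have "norm (\<Sum>i<n. t ^ i) \<le> (\<Sum>i<n. 2 ^ n)"
  proof (rule sum_norm_le)
    fix i assume "i \<in> {..<n}"
    have "norm (t ^ i) \<le> 2 ^ i" unfolding norm_power using \<open>norm t \<le> 2\<close> by (intro power_mono) auto
    also have "\<dots> \<le> 2 ^ n" using \<open>i \<in> {..<n}\<close> by (intro power_increasing) auto
    finally show "norm (t ^ i) \<le> 2 ^ n" .
  qed
  hence "norm (1 / z) * norm (\<Sum>i<n. t ^ i) \<le> 1 / a * (real n * 2 ^ n)"
    using z assms by (intro mult_mono) auto
  moreover have "1 - t ^ n = 1 / z * (\<Sum>i<n. t ^ i)"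
    by (subst one_diff_power_eq) (simp add: t_def)
  hence "norm (1 - t ^ n) = norm (1 / z) * norm (\<Sum>i<n. t ^ i)" by (simp only: norm_mult)
  ultimately show ?thesis by (simp add: t_def)
qed

text \<open>The symmetric truncations are finite and eventually contain any given finite set of
  zeros, so the unordered sum is also their limit.\<close>

lemma zero_partial_sum_tendsto:
  assumes "(\<lambda>\<rho>. of_int (zorder zeta \<rho>) * f \<rho>) summable_on nontrivial_zeros"
  shows "(zero_partial_sum f \<longlongrightarrow> infsum (\<lambda>\<rho>. of_int (zorder zeta \<rho>) * f \<rho>) nontrivial_zeros) at_top"
proof -
  have "filterlim (\<lambda>T. {\<rho> \<in> nontrivial_zeros. \<bar>Im \<rho>\<bar> < T}) (finite_subsets_at_top nontrivial_zeros) at_top"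
    unfolding filterlim_finite_subsets_at_top
  proof (intro allI impI)
    fix F assume F: "finite F \<and> F \<subseteq> nontrivial_zeros"
    have "\<forall>\<^sub>F T in at_top. T > Max (insert 0 ((\<lambda>\<rho>. \<bar>Im \<rho>\<bar>) ` F))" by (rule eventually_gt_at_top)
    thus "\<forall>\<^sub>F T in at_top. finite {\<rho> \<in> nontrivial_zeros. \<bar>Im \<rho>\<bar> < T} \<and>
        F \<subseteq> {\<rho> \<in> nontrivial_zeros. \<bar>Im \<rho>\<bar> < T} \<and> {\<rho> \<in> nontrivial_zeros. \<bar>Im \<rho>\<bar> < T} \<subseteq> nontrivial_zeros"
    proof eventually_elim
      case (elim T)
      thus ?case using F finite_nontrivial_zeros_strip by auto
    qed
  qed
  thus ?thesis
    using has_sum_infsum[OF assms] unfolding has_sum_def zero_partial_sum_def[abs_def]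
    by (rule filterlim_compose[rotated])
qed

lemma zero_partial_sum_reflect:
  "zero_partial_sum (\<lambda>\<rho>. f (1 - \<rho>)) T = zero_partial_sum f T"
  unfolding zero_partial_sum_def
  by (rule sum.reindex_bij_witness[of _ "\<lambda>\<rho>. 1 - \<rho>" "\<lambda>\<rho>. 1 - \<rho>"])
     (auto simp: nontrivial_zeros_reflect)

section \<open>The Li coefficients\<close>

theorem theorem3:
  fixes n :: nat and r :: "complex \<Rightarrow> complex"
  assumes "n \<ge> 1"
    and "\<And>\<rho>. \<rho> \<in> nontrivial_zeros \<Longrightarrow> (r \<rho>)\<^sup>2 = (1 - 1 / \<rho>) ^ n"
  shows "zero_summable (\<lambda>\<rho>. 1 - (1 - 1 / \<rho>) ^ n) \<and>
         zero_summable (\<lambda>\<rho>. (r \<rho> - 1 / r \<rho>)\<^sup>2) \<and>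
         li_coeff n = - (1 / 2) * zero_sum (\<lambda>\<rho>. (r \<rho> - 1 / r \<rho>)\<^sup>2)"
proof -
  define f where "f = (\<lambda>\<rho>::complex. 1 - (1 - 1 / \<rho>) ^ n)"
  \<comment> \<open>Half the product is the same as the average of \<open>f \<rho>\<close> and
    \<open>f (1 - \<rho>)\<close>, because the two powers inside are inverse to each other (fact
    \<open>prod\<close>). The product form displays the quadratic decay.\<close>
  define h where "h = (\<lambda>\<rho>. f \<rho> * f (1 - \<rho>) / 2)"
  define q where "q = (\<lambda>\<rho>. (r \<rho> - 1 / r \<rho>)\<^sup>2)"
  define m where "m = (\<lambda>\<rho>. of_int (zorder zeta \<rho>) :: complex)"
  have t: "(1 - 1 / \<rho>) * (1 - 1 / (1 - \<rho>)) = 1" if "\<rho> \<in> nontrivial_zeros" for \<rho>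
    using nontrivial_zeros_Re(3,4)[OF that] by (simp add: field_simps)
  have prod: "f \<rho> * f (1 - \<rho>) = f \<rho> + f (1 - \<rho>)" if "\<rho> \<in> nontrivial_zeros" for \<rho>
  proof -
    have "(1 - 1 / \<rho>) ^ n * (1 - 1 / (1 - \<rho>)) ^ n = 1"
      using t[OF that] by (simp only: power_mult_distrib[symmetric]) simp
    thus ?thesis by (simp add: f_def algebra_simps)
  qed
  \<comment> \<open>Expanding the square leaves only \<open>(r \<rho>)\<^sup>2\<close> and its
    inverse, so the choice of the square root is irrelevant.\<close>
  have q: "q \<rho> = - (f \<rho> * f (1 - \<rho>))" if \<rho>: "\<rho> \<in> nontrivial_zeros" for \<rho>
  proof -
    have eq: "(r \<rho>)\<^sup>2 * (1 - 1 / (1 - \<rho>)) ^ n = 1"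
      unfolding assms(2)[OF \<rho>] power_mult_distrib[symmetric] t[OF \<rho>] by simp
    hence "r \<rho> \<noteq> 0" by auto
    have "(1 - 1 / (1 - \<rho>)) ^ n = 1 / (r \<rho>)\<^sup>2"
      using eq \<open>r \<rho> \<noteq> 0\<close> by (simp add: field_simps)
    hence "f \<rho> + f (1 - \<rho>) = 2 - (r \<rho>)\<^sup>2 - 1 / (r \<rho>)\<^sup>2"
      using assms(2)[OF \<rho>] by (simp add: f_def)
    moreover have "q \<rho> = (r \<rho>)\<^sup>2 + 1 / (r \<rho>)\<^sup>2 - 2"
      using \<open>r \<rho> \<noteq> 0\<close> by (simp add: q_def power2_eq_square field_simps)
    ultimately show ?thesis using prod[OF \<rho>] by simp
  qed
  have PS_f: "zero_partial_sum f T = zero_partial_sum h T" for T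
  proof -
    have "2 * zero_partial_sum f T = zero_partial_sum f T + zero_partial_sum (\<lambda>\<rho>. f (1 - \<rho>)) T"
      unfolding zero_partial_sum_reflect by simp
    also have "\<dots> = 2 * zero_partial_sum h T"
      unfolding zero_partial_sum_def sum.distrib[symmetric] sum_distrib_left
      by (intro sum.cong) (auto simp: h_def prod algebra_simps)
    finally show ?thesis by simp
  qed
  have PS_q: "zero_partial_sum q T = - 2 * zero_partial_sum h T" for T
    unfolding zero_partial_sum_def sum_distrib_left
    by (intro sum.cong) (auto simp: h_def q)
  have "(\<lambda>\<rho>. m \<rho> * h \<rho>) summable_on nontrivial_zeros"
  proof -
    \<comment> \<open>The decay estimate needs |Im \<rho>| \<ge> 1; only finitely many zeros are
      left out.\<close>
    define N1 where "N1 = {\<rho> \<in> nontrivial_zeros. \<bar>Im \<rho>\<bar> \<ge> 1}"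
    define N2 where "N2 = {\<rho> \<in> nontrivial_zeros. \<bar>Im \<rho>\<bar> < 1}"
    define K where "K = (real n * 2 ^ n)\<^sup>2"
    have "(\<lambda>\<rho>. m \<rho> * h \<rho>) summable_on N2"
      unfolding N2_def by (intro summable_on_finite finite_nontrivial_zeros_strip)
    moreover have "(\<lambda>\<rho>. m \<rho> * h \<rho>) summable_on N1"
    proof (rule abs_summable_summable, rule summable_on_comparison_test)
      show "(\<lambda>\<rho>. K * (real_of_int (zorder zeta \<rho>) / (1 + (Im \<rho>)\<^sup>2))) summable_on N1"
        by (intro summable_on_cmult_right summable_on_subset_banach[OF summable_zorder_over_square])
           (auto simp: N1_def)
      fix \<rho> assume "\<rho> \<in> N1"
      hence \<rho>: "\<rho> \<in> nontrivial_zeros" "\<bar>Im \<rho>\<bar> \<ge> 1" by (auto simp: N1_def)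
      define a where "a = \<bar>Im \<rho>\<bar>"
      have a: "a \<ge> 1" "norm \<rho> \<ge> a" "norm (1 - \<rho>) \<ge> a"
        using \<rho> abs_Im_le_cmod[of \<rho>] abs_Im_le_cmod[of "1 - \<rho>"] by (auto simp: a_def)
      have "norm (f \<rho>) * norm (f (1 - \<rho>)) \<le> (real n * 2 ^ n / a) * (real n * 2 ^ n / a)"
        unfolding f_def using a by (intro mult_mono norm_one_minus_power_le) auto
      also have "\<dots> = K / a\<^sup>2" by (simp add: K_def power2_eq_square)
      finally have "norm (h \<rho>) \<le> K / (2 * a\<^sup>2)"
        by (simp add: h_def norm_mult norm_divide)
      also have "\<dots> \<le> K / (1 + a\<^sup>2)"
        using a(1) by (intro divide_left_mono mult_pos_pos) (auto simp: K_def one_le_power add_pos_nonneg)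
      finally have "norm (h \<rho>) \<le> K / (1 + (Im \<rho>)\<^sup>2)" by (simp add: a_def)
      hence "norm (m \<rho>) * norm (h \<rho>) \<le> real_of_int (zorder zeta \<rho>) * (K / (1 + (Im \<rho>)\<^sup>2))"
        using zorder_zeta_pos[OF \<rho>(1)] by (intro mult_mono) (auto simp: m_def)
      thus "norm (m \<rho> * h \<rho>) \<le> K * (real_of_int (zorder zeta \<rho>) / (1 + (Im \<rho>)\<^sup>2))"
        by (simp add: norm_mult mult_ac)
    qed auto
    moreover have "N1 \<union> N2 = nontrivial_zeros" "N1 \<inter> N2 = {}"
      by (auto simp: N1_def N2_def)
    ultimately show ?thesis using summable_on_Un_disjoint[of _ N1 N2] by metis
  qed
  then obtain L where "(zero_partial_sum h \<longlongrightarrow> L) at_top"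
    unfolding m_def using zero_partial_sum_tendsto by blast
  hence f: "(zero_partial_sum f \<longlongrightarrow> L) at_top"
    and q: "(zero_partial_sum q \<longlongrightarrow> - 2 * L) at_top"
    using tendsto_mult_left[of "zero_partial_sum h" L at_top "- 2"] by (simp_all add: PS_f[abs_def] PS_q[abs_def])
  have "zero_sum f = L" "zero_sum q = - 2 * L"
    unfolding zero_sum_def by (intro tendsto_Lim f q; simp)+
  moreover have "li_coeff n = zero_sum f" by (simp add: li_coeff_def f_def)
  ultimately show ?thesis
    using f q unfolding zero_summable_def f_def[symmetric] q_def[symmetric] by auto
qed

end
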